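(* For every integer $n \geq 3$, we have $P^{A_n} = \Sigma^{A_n}$ if and only if $n$ is odd.
   Context: Let $\mathbf{x} = (\mathbf{x}_1,\ldots,\mathbf{x}_{n+1})$ be $n+1$ variables and let $p_k = \sum_{i=1}^{n+1} \mathbf{x}_i^k \in \mathbb{R}[\mathbf{x}]$ be the power sum of degree $k$. Let $U_n = \{a \in \mathbb{R}^{n+1} : \sum_{i=1}^{n+1} a_i = 0\}$. The reflection group $A_n$ is the symmetric group $S_{n+1}$ acting on the $n$-dimensional space $U_n$ by permuting coordinates. It acts on the quotient ring $\mathbb{R}[\mathbf{x}]/(p_1)$ (identified, $A_n$-equivariantly, with the ring of polynomial functions on $U_n$, a polynomial ring in $n$ variables) by permuting the $\mathbf{x}_i$. An $A_n$-invariant quartic is an $A_n$-invariant homogeneous element of degree $4$ of $\mathbb{R}[\mathbf{x}]/(p_1)$; the vector space of $A_n$-invariant quartics is spanned by the classes of $p_2^2$ and $p_4$. An $A_n$-invariant quartic in $\mathbb{R}[\mathbf{x}]/(p_1)$ is called nonnegative (psd) if any representative of its class in $\mathbb{R}[\mathbf{x}]$ is nonnegative at all points of $U_n$ (this does not depend on the representative). It is called a sum of squares (sos) if some representative of its class in $\mathbb{R}[\mathbf{x}]$ is of the form $g_1^2 + \cdots + g_m^2 + p_1 g$ with $g_1,\ldots,g_m,g \in \mathbb{R}[\mathbf{x}]$. $P^{A_n}$ denotes the set of all psd $A_n$-invariant quartics and $\Sigma^{A_n}$ denotes the set of all sos $A_n$-invariant quartics. *)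

theory Defs
  imports Complex_Main "HOL-Library.FuncSet" "HOL-Library.Poly_Mapping"
    "HOL-Combinatorics.Permutations" "HOL-Algebra.QuotRing"
begin

text \<open>
  Real polynomials are finitely supported functions from monomials to coefficients, a monomial
  being a finitely supported exponent vector. The type provides infinitely many variables; the
  ring in the $n+1$ variables $x_1, \dots, x_{n+1}$ is carved out by \<open>poly_ring n\<close> below.
\<close>

type_synonym mpoly = "(nat \<Rightarrow>\<^sub>0 nat) \<Rightarrow>\<^sub>0 real"

definition X :: "nat \<Rightarrow> mpoly" where
  "X i = Poly_Mapping.single (Poly_Mapping.single i 1) 1"

definition poly_ring :: "nat \<Rightarrow> mpoly ring" where
  "poly_ring n =
     \<lparr>carrier = {f. \<forall>m \<in> Poly_Mapping.keys f. Poly_Mapping.keys m \<subseteq> {1..n + 1}},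
      mult = (*), one = 1, zero = 0, add = (+)\<rparr>"

definition power_sum :: "nat \<Rightarrow> nat \<Rightarrow> mpoly" where
  "power_sum n k = (\<Sum>i = 1..n + 1. X i ^ k)"

definition quot_ring :: "nat \<Rightarrow> mpoly set ring" where
  "quot_ring n = poly_ring n Quot (PIdl\<^bsub>poly_ring n\<^esub> (power_sum n 1))"

definition eval_poly :: "(nat \<Rightarrow> real) \<Rightarrow> mpoly \<Rightarrow> real" where
  "eval_poly a f = (\<Sum>m \<in> Poly_Mapping.keys f. Poly_Mapping.lookup f m *
                 (\<Prod>i \<in> Poly_Mapping.keys m. a i ^ Poly_Mapping.lookup m i))"

text \<open>Points of $\mathbb{R}^{n+1}$ are the functions on \<open>{1..n + 1}\<close> (extensional outside).\<close>

definition U :: "nat \<Rightarrow> (nat \<Rightarrow> real) set" where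
  "U n = {a \<in> {1..n + 1} \<rightarrow>\<^sub>E UNIV. (\<Sum>i = 1..n + 1. a i) = 0}"

definition homogeneous :: "nat \<Rightarrow> mpoly \<Rightarrow> bool" where
  "homogeneous d f \<longleftrightarrow>
     (\<forall>m \<in> Poly_Mapping.keys f. (\<Sum>i \<in> Poly_Mapping.keys m. Poly_Mapping.lookup m i) = d)"

text \<open>
  For a permutation \<open>\<sigma>\<close>, the coefficient of $x^m$ in $\sigma f$ is the coefficient of
  $x^{m \circ \sigma}$ in $f$; this is the algebra automorphism with $x_i \mapsto x_{\sigma(i)}$.
\<close>

definition permute :: "(nat \<Rightarrow> nat) \<Rightarrow> mpoly \<Rightarrow> mpoly" where
  "permute \<sigma> f = Poly_Mapping.map_key (Poly_Mapping.map_key \<sigma>) f"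

text \<open>
  Elements of the quotient ring are cosets, i.e. sets of representatives. As $(p_1)$ is generated
  by a homogeneous invariant polynomial, the quotient inherits the grading (a class is homogeneous
  iff it has a homogeneous representative) and the group action (by taking images of cosets).
\<close>

definition invariant_quartics :: "nat \<Rightarrow> mpoly set set" where
  "invariant_quartics n = {C \<in> carrier (quot_ring n).
     (\<exists>f \<in> C. homogeneous 4 f) \<and> (\<forall>\<sigma>. \<sigma> permutes {1..n + 1} \<longrightarrow> permute \<sigma> ` C = C)}"

definition psd_quartics :: "nat \<Rightarrow> mpoly set set" where
  "psd_quartics n = {C \<in> invariant_quartics n. \<forall>f \<in> C. \<forall>a \<in> U n. 0 \<le> eval_poly a f}"

definition sos_quartics :: "nat \<Rightarrow> mpoly set set" where
  "sos_quartics n = {C \<in> invariant_quartics n. \<exists>f \<in> C. \<exists>(l::nat) (g :: nat \<Rightarrow> mpoly) h.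
     (\<forall>j \<in> {1..l}. g j \<in> carrier (poly_ring n)) \<and> h \<in> carrier (poly_ring n) \<and>
     f = (\<Sum>j = 1..l. g j ^ 2) + power_sum n 1 * h}"

lemma poly_ring_closed:
  assumes "f \<in> carrier (poly_ring n)" "g \<in> carrier (poly_ring n)"
  shows "f + g \<in> carrier (poly_ring n)" "f * g \<in> carrier (poly_ring n)"
    "- f \<in> carrier (poly_ring n)"
proof -
  have fg: "Poly_Mapping.keys m \<subseteq> {1..n + 1}"
    if "m \<in> Poly_Mapping.keys f \<union> Poly_Mapping.keys g" for m
    using assms that unfolding poly_ring_def by auto
  show "f + g \<in> carrier (poly_ring n)"
    unfolding poly_ring_def using fg keys_add[of f g] by (simp only: partial_object.simps) blast
  show "- f \<in> carrier (poly_ring n)"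
    using fg unfolding poly_ring_def by simp
  have "Poly_Mapping.keys m \<subseteq> {1..n + 1}" if m: "m \<in> Poly_Mapping.keys (f * g)" for m
  proof -
    obtain a b where "m = a + b" "a \<in> Poly_Mapping.keys f" "b \<in> Poly_Mapping.keys g"
      using m keys_mult[of f g] by blast
    then show ?thesis
      using keys_add[of a b] fg[of a] fg[of b] by blast
  qed
  then show "f * g \<in> carrier (poly_ring n)"
    unfolding poly_ring_def by simp
qed

lemma poly_ring_simps [simp]:
  "x \<otimes>\<^bsub>poly_ring n\<^esub> y = x * y" "x \<oplus>\<^bsub>poly_ring n\<^esub> y = x + y"
  "\<one>\<^bsub>poly_ring n\<^esub> = 1" "\<zero>\<^bsub>poly_ring n\<^esub> = 0"
  "0 \<in> carrier (poly_ring n)" "1 \<in> carrier (poly_ring n)"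
  by (simp_all add: poly_ring_def)

lemma cring_poly_ring: "cring (poly_ring n)"
proof (rule cringI)
  show "abelian_group (poly_ring n)"
  proof (rule abelian_groupI)
    fix f assume "f \<in> carrier (poly_ring n)"
    then show "\<exists>g\<in>carrier (poly_ring n). g \<oplus>\<^bsub>poly_ring n\<^esub> f = \<zero>\<^bsub>poly_ring n\<^esub>"
      by (intro bexI[of _ "- f"]) (simp_all add: poly_ring_closed)
  qed (simp_all add: poly_ring_closed add_ac)
  show "comm_monoid (poly_ring n)"
    by (rule comm_monoidI) (simp_all add: poly_ring_closed mult_ac)
qed (simp add: distrib_right)

lemma permute_X:
  assumes "\<sigma> permutes A"
  shows "permute \<sigma> (X i) = X (\<sigma> i)"
proof -
  have s: "surj \<sigma>" and i: "inj \<sigma>"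
    using assms permutes_surj permutes_inj by blast+
  have inj: "inj (Poly_Mapping.map_key \<sigma> :: (nat \<Rightarrow>\<^sub>0 nat) \<Rightarrow> _)"
  proof (rule injI)
    fix p q :: "nat \<Rightarrow>\<^sub>0 nat"
    assume eq: "Poly_Mapping.map_key \<sigma> p = Poly_Mapping.map_key \<sigma> q"
    have "Poly_Mapping.lookup p (\<sigma> k) = Poly_Mapping.lookup q (\<sigma> k)" for k
      using arg_cong[OF eq, of "\<lambda>r. Poly_Mapping.lookup r k"] i by (simp add: map_key.rep_eq)
    then show "p = q"
      by (intro poly_mapping_eqI) (metis s surjD)
  qed
  have "Poly_Mapping.map_key \<sigma> (Poly_Mapping.single (\<sigma> i) 1) = Poly_Mapping.single i (1::nat)"
    using i by simp
  then show ?thesis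
    unfolding permute_def X_def using map_key_single[OF inj] by metis
qed

end

theory Submission
  imports Defs "HOL-Computational_Algebra.Polynomial"
begin

text \<open>
  Write \<open>N = n + 1\<close>. Modulo \<open>p\<^sub>1\<close> every invariant quartic is \<open>a p\<^sub>4 + b p\<^sub>2\<^sup>2\<close>, so both sides
  of the equation are convex cones in a plane, and the question is which lines bound them.

  On the hyperplane \<open>p\<^sub>1 = 0\<close> the ratio \<open>p\<^sub>4 / p\<^sub>2\<^sup>2\<close> is at most \<open>(N\<^sup>2 - 3N + 3) / (N (N - 1))\<close>, its
  value at the simplex vertex \<open>(N - 1, -1, \<dots>, -1)\<close>, and at least \<open>1 / N\<close>. Both bounds have
  certificates for every \<open>N > 2\<close>: the lower one is Lagrange's identity
  \<open>\<Sum>\<^sub>i\<^sub>j (x\<^sub>i\<^sup>2 - x\<^sub>j\<^sup>2)\<^sup>2 = 2 (N p\<^sub>4 - p\<^sub>2\<^sup>2)\<close>, the upper one is \<open>sum_squares_two_index\<close>.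
  The two certificates generate the cone of all \<open>a p\<^sub>4 + b p\<^sub>2\<^sup>2\<close> that are nonnegative both at the
  vertex and at ratio \<open>1 / N\<close> (\<open>is_sos_if_nonneg_on_rays\<close>). The ratio \<open>1 / N\<close> requires that all
  \<open>|x\<^sub>i|\<close> agree, which on the hyperplane is possible exactly when \<open>N\<close> is even, as many coordinates
  being \<open>1\<close> as \<open>-1\<close>. So for odd \<open>n\<close> a nonnegative quartic satisfies both conditions and is a sum of
  squares.

  For odd \<open>N\<close> the minimum of the ratio exceeds \<open>1 / N\<close>, by at least \<open>1 / N\<^sup>3\<close>
  (\<open>psd_separating_quartic\<close>), so \<open>p\<^sub>4 - (1 / N + 1 / N\<^sup>3) p\<^sub>2\<^sup>2\<close> is nonnegative. It is not a sum of
  squares because sums of squares do not see the parity of \<open>N\<close>: they still satisfy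
  \<open>a + b N \<ge> 0\<close> (\<open>is_sos_necessary\<close>). The reason is the linear functional
  \<open>L f = N\<^sup>2 (N - 2) \<Sum>\<^sub>i\<^sub>j f (e\<^sub>i - e\<^sub>j) - 2 \<Sum>\<^sub>i f (N e\<^sub>i - (1, \<dots>, 1))\<close>.
  On \<open>a p\<^sub>4 + b p\<^sub>2\<^sup>2\<close> it is a positive multiple of \<open>a + b N\<close>, hence for even \<open>N\<close> it is a positive multiple
  of averaging the quartic over the balanced sign vectors; for odd \<open>N\<close> it is a substitute
  for that average which has no underlying points but remains nonnegative on squares of quadratic forms
  (\<open>zero_diagonal_matrix_bound\<close>).
\<close>

section \<open>Constants, monomials and evaluation\<close>

abbreviation Const :: "real \<Rightarrow> mpoly" where
  "Const c \<equiv> Poly_Mapping.single 0 c"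

abbreviation monom_value :: "(nat \<Rightarrow> real) \<Rightarrow> (nat \<Rightarrow>\<^sub>0 nat) \<Rightarrow> real" where
  "monom_value a m \<equiv> (\<Prod>i\<in>Poly_Mapping.keys m. a i ^ Poly_Mapping.lookup m i)"

abbreviation monom_degree :: "(nat \<Rightarrow>\<^sub>0 nat) \<Rightarrow> nat" where
  "monom_degree m \<equiv> (\<Sum>i\<in>Poly_Mapping.keys m. Poly_Mapping.lookup m i)"

lemma mpoly_expand:
  "f = (\<Sum>m\<in>Poly_Mapping.keys f. Poly_Mapping.single m (Poly_Mapping.lookup f m))"
  for f :: "'a \<Rightarrow>\<^sub>0 'b::comm_monoid_add"
  by (rule poly_mapping_eqI)
    (auto simp: lookup_sum lookup_single when_def in_keys_iff sum.delta)

text \<open>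
  Adding one term at a time makes multiplicativity of an additive map a statement about products
  of two single terms.
\<close>

lemma mpoly_induct [case_names zero single_add]:
  fixes f :: "'a \<Rightarrow>\<^sub>0 'b::comm_monoid_add"
  assumes "P 0" and "\<And>m c f. P f \<Longrightarrow> P (Poly_Mapping.single m c + f)"
  shows "P f"
proof -
  have "P (\<Sum>m\<in>S. Poly_Mapping.single m (Poly_Mapping.lookup f m))" if "finite S" for S
    using that by induction (simp_all add: assms)
  from this[OF finite_keys, of f] show ?thesis
    by (subst mpoly_expand)
qed

lemma Const_hom:
  "Const 0 = 0" "Const 1 = 1" "Const (a + b) = Const a + Const b" "Const (a * b) = Const a * Const b"
  "Const (- a) = - Const a" "Const (a - b) = Const a - Const b"
  by (simp_all add: single_add single_uminus single_diff mult_single)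

lemma Const_of_nat: "Const (of_nat k) = of_nat k"
  by simp

lemma Const_power: "Const (a ^ k) = Const a ^ k"
  by (induction k) (simp_all add: Const_hom)

lemma monom_value_superset:
  assumes "finite S" "Poly_Mapping.keys m \<subseteq> S"
  shows "monom_value a m = (\<Prod>i\<in>S. a i ^ Poly_Mapping.lookup m i)"
  using assms by (intro prod.mono_neutral_left) (auto simp: in_keys_iff)

lemma monom_value_add: "monom_value a (l + m) = monom_value a l * monom_value a m"
proof -
  let ?S = "Poly_Mapping.keys l \<union> Poly_Mapping.keys m"
  have "monom_value a (l + m) = (\<Prod>i\<in>?S. a i ^ Poly_Mapping.lookup (l + m) i)"
    by (intro monom_value_superset) (simp_all add: keys_add)
  also have "\<dots> = (\<Prod>i\<in>?S. a i ^ Poly_Mapping.lookup l i) * (\<Prod>i\<in>?S. a i ^ Poly_Mapping.lookup m i)"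
    by (simp add: lookup_add power_add prod.distrib)
  also have "\<dots> = monom_value a l * monom_value a m"
    by (subst (1 2) monom_value_superset[of ?S]) simp_all
  finally show ?thesis .
qed

lemma eval_poly_superset:
  assumes "finite S" "Poly_Mapping.keys f \<subseteq> S"
  shows "eval_poly a f = (\<Sum>m\<in>S. Poly_Mapping.lookup f m * monom_value a m)"
  unfolding eval_poly_def using assms
  by (intro sum.mono_neutral_left) (auto simp: in_keys_iff)

lemma eval_poly_add [simp]: "eval_poly a (f + g) = eval_poly a f + eval_poly a g"
proof -
  let ?S = "Poly_Mapping.keys f \<union> Poly_Mapping.keys g"
  have "eval_poly a (f + g) = (\<Sum>m\<in>?S. Poly_Mapping.lookup (f + g) m * monom_value a m)"
    by (intro eval_poly_superset) (simp_all add: keys_add)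
  also have "\<dots> = (\<Sum>m\<in>?S. Poly_Mapping.lookup f m * monom_value a m)
      + (\<Sum>m\<in>?S. Poly_Mapping.lookup g m * monom_value a m)"
    by (simp add: lookup_add distrib_right sum.distrib)
  also have "\<dots> = eval_poly a f + eval_poly a g"
    by (subst (1 2) eval_poly_superset[of ?S]) simp_all
  finally show ?thesis .
qed

lemma eval_poly_single: "eval_poly a (Poly_Mapping.single m c) = c * monom_value a m"
  by (subst eval_poly_superset[of "{m}"]) simp_all

lemma eval_poly_0 [simp]: "eval_poly a 0 = 0"
  by (simp add: eval_poly_def)

lemma eval_poly_Const [simp]: "eval_poly a (Const c) = c"
  by (simp add: eval_poly_single)

lemma eval_poly_1 [simp]: "eval_poly a 1 = 1"
  using eval_poly_Const[of a 1] by simp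

lemma eval_poly_mult [simp]: "eval_poly a (f * g) = eval_poly a f * eval_poly a g"
proof -
  have single: "eval_poly a (Poly_Mapping.single m c * g)
      = eval_poly a (Poly_Mapping.single m c) * eval_poly a g" for m c
    by (induction g rule: mpoly_induct)
      (simp_all add: distrib_left mult_single eval_poly_single monom_value_add)
  show ?thesis
    by (induction f rule: mpoly_induct) (simp_all add: distrib_right single)
qed

lemma eval_poly_power [simp]: "eval_poly a (f ^ k) = eval_poly a f ^ k"
  by (induction k) simp_all

lemma eval_poly_sum [simp]: "eval_poly a (sum f S) = (\<Sum>i\<in>S. eval_poly a (f i))"
  by (induction S rule: infinite_finite_induct) simp_all

lemma eval_poly_X [simp]: "eval_poly a (X i) = a i"
  by (simp add: X_def eval_poly_single)

lemma eval_power_sum: "eval_poly a (power_sum n k) = (\<Sum>i=1..n+1. a i ^ k)"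
  unfolding power_sum_def by simp

section \<open>The polynomial ring in finitely many variables\<close>

lemma carrier_poly_ring:
  "carrier (poly_ring n) = {f. \<forall>m\<in>Poly_Mapping.keys f. Poly_Mapping.keys m \<subseteq> {1..n+1}}"
  by (simp add: poly_ring_def)

lemma Const_closed: "Const c \<in> carrier (poly_ring n)"
  by (simp add: carrier_poly_ring)

lemma X_closed: "i \<in> {1..n+1} \<Longrightarrow> X i \<in> carrier (poly_ring n)"
  by (simp add: carrier_poly_ring X_def)

lemma power_closed: "f \<in> carrier (poly_ring n) \<Longrightarrow> f ^ k \<in> carrier (poly_ring n)"
  by (induction k) (simp_all add: poly_ring_closed)

lemma sum_closed: "(\<And>i. i \<in> S \<Longrightarrow> f i \<in> carrier (poly_ring n)) \<Longrightarrow> sum f S \<in> carrier (poly_ring n)"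
  by (induction S rule: infinite_finite_induct) (simp_all add: poly_ring_closed)

lemma diff_closed:
  "f \<in> carrier (poly_ring n) \<Longrightarrow> g \<in> carrier (poly_ring n) \<Longrightarrow> f - g \<in> carrier (poly_ring n)"
  using poly_ring_closed(1)[OF _ poly_ring_closed(3), of f n g] by simp

lemma power_sum_closed: "power_sum n k \<in> carrier (poly_ring n)"
  unfolding power_sum_def by (intro sum_closed power_closed X_closed)

lemmas closed = poly_ring_closed(1,2) poly_ring_closed(3)[OF _ poly_ring_simps(5)]
  Const_closed X_closed power_closed sum_closed diff_closed power_sum_closed poly_ring_simps(5,6)

section \<open>The action of the symmetric group\<close>

lemma inj_map_key:
  assumes "surj \<sigma>" "inj \<sigma>"
  shows "inj (Poly_Mapping.map_key \<sigma> :: ('b \<Rightarrow>\<^sub>0 'c::zero) \<Rightarrow> _)"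
proof (rule injI)
  fix p q :: "'b \<Rightarrow>\<^sub>0 'c"
  assume eq: "Poly_Mapping.map_key \<sigma> p = Poly_Mapping.map_key \<sigma> q"
  have "Poly_Mapping.lookup p (\<sigma> k) = Poly_Mapping.lookup q (\<sigma> k)" for k
    using arg_cong[OF eq, of "\<lambda>r. Poly_Mapping.lookup r k"] assms by (simp add: map_key.rep_eq)
  then show "p = q"
    by (intro poly_mapping_eqI) (metis assms(1) surjD)
qed

lemma inj_map_key_permutes:
  assumes "\<sigma> permutes A"
  shows "inj (Poly_Mapping.map_key \<sigma> :: ('b \<Rightarrow>\<^sub>0 'c::zero) \<Rightarrow> _)"
  by (rule inj_map_key[OF permutes_surj[OF assms] permutes_inj[OF assms]])

lemma permute_add:
  assumes "\<sigma> permutes A"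
  shows "permute \<sigma> (f + g) = permute \<sigma> f + permute \<sigma> g"
  unfolding permute_def by (rule map_key_plus[OF inj_map_key_permutes[OF assms]])

lemma permute_0:
  assumes "\<sigma> permutes A"
  shows "permute \<sigma> 0 = 0"
  unfolding permute_def by (rule map_key_zero[OF inj_map_key_permutes[OF assms]])

lemma permute_sum:
  assumes "\<sigma> permutes A"
  shows "permute \<sigma> (sum f S) = (\<Sum>i\<in>S. permute \<sigma> (f i))"
  by (induction S rule: infinite_finite_induct) (simp_all add: permute_0[OF assms] permute_add[OF assms])

text \<open>
  The action is defined by pulling coefficients back, so on a single term it acts by the inverse
  permutation of the exponents.
\<close>

lemma permute_single:
  assumes "\<sigma> permutes A"
  shows "permute \<sigma> (Poly_Mapping.single m c)
    = Poly_Mapping.single (Poly_Mapping.map_key (inv_into UNIV \<sigma>) m) c"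
proof -
  have "Poly_Mapping.map_key \<sigma> (Poly_Mapping.map_key (inv_into UNIV \<sigma>) m) = Poly_Mapping.map_key (inv_into UNIV \<sigma> \<circ> \<sigma>) m"
    by (intro map_key_compose permutes_inj[OF assms] permutes_inj[OF permutes_inv[OF assms]])
  also have "inv_into UNIV \<sigma> \<circ> \<sigma> = (\<lambda>x. x)"
    using permutes_inv_o(2)[OF assms] by (simp add: id_def)
  finally have "Poly_Mapping.map_key \<sigma> (Poly_Mapping.map_key (inv_into UNIV \<sigma>) m) = m"
    by (simp add: map_key_id)
  then show ?thesis
    unfolding permute_def using map_key_single[OF inj_map_key_permutes[OF assms]] by metis
qed

lemma permute_mult:
  assumes "\<sigma> permutes A"
  shows "permute \<sigma> (f * g) = permute \<sigma> f * permute \<sigma> g"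
proof -
  have inj: "inj (inv_into UNIV \<sigma>)"
    using permutes_inj[OF permutes_inv[OF assms]] .
  note simps = permute_add[OF assms] permute_0[OF assms] permute_single[OF assms]
  have single: "permute \<sigma> (Poly_Mapping.single m c * g)
      = permute \<sigma> (Poly_Mapping.single m c) * permute \<sigma> g" for m c
    by (induction g rule: mpoly_induct)
      (simp_all add: distrib_left mult_single simps map_key_plus[OF inj])
  show ?thesis
    by (induction f rule: mpoly_induct) (simp_all add: simps distrib_right single)
qed

lemma permute_Const:
  assumes "\<sigma> permutes A"
  shows "permute \<sigma> (Const c) = Const c"
proof -
  have "inj (inv_into UNIV \<sigma>)"
    using permutes_inj[OF permutes_inv[OF assms]] .
  then show ?thesis
    by (simp add: permute_single[OF assms])
qed

lemma permute_1:
  assumes "\<sigma> permutes A"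
  shows "permute \<sigma> 1 = 1"
  using permute_Const[OF assms, of 1] by simp

lemma permute_power:
  assumes "\<sigma> permutes A"
  shows "permute \<sigma> (f ^ k) = permute \<sigma> f ^ k"
  by (induction k) (simp_all add: permute_1[OF assms] permute_mult[OF assms])

lemma permute_permute:
  assumes "\<sigma> permutes A" "\<tau> permutes A"
  shows "permute \<sigma> (permute \<tau> f) = permute (\<sigma> \<circ> \<tau>) f"
proof -
  have "Poly_Mapping.map_key \<tau> (Poly_Mapping.map_key \<sigma> m) = Poly_Mapping.map_key (\<sigma> \<circ> \<tau>) m"
    for m :: "nat \<Rightarrow>\<^sub>0 nat"
    by (intro map_key_compose permutes_inj[OF assms(1)] permutes_inj[OF assms(2)])
  then show ?thesis
    unfolding permute_def
    by (subst map_key_compose) (simp_all add: inj_map_key_permutes[OF assms(1)]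
      inj_map_key_permutes[OF assms(2)] comp_def)
qed

lemma permute_closed:
  assumes "\<sigma> permutes {1..n+1}" "f \<in> carrier (poly_ring n)"
  shows "permute \<sigma> f \<in> carrier (poly_ring n)"
proof -
  have "Poly_Mapping.keys m \<subseteq> {1..n+1}" if "m \<in> Poly_Mapping.keys (permute \<sigma> f)" for m
  proof -
    have "Poly_Mapping.map_key \<sigma> m \<in> Poly_Mapping.keys f"
      using that by (simp add: permute_def keys_map_key[OF inj_map_key_permutes[OF assms(1)]])
    then have "Poly_Mapping.keys (Poly_Mapping.map_key \<sigma> m) \<subseteq> {1..n+1}"
      using assms(2) unfolding carrier_poly_ring by blast
    then have "\<sigma> -` Poly_Mapping.keys m \<subseteq> {1..n+1}"
      by (simp only: keys_map_key[OF permutes_inj[OF assms(1)]])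
    then have "\<sigma> ` (\<sigma> -` Poly_Mapping.keys m) \<subseteq> {1..n+1}"
      using permutes_image[OF assms(1)] by blast
    then show ?thesis
      using permutes_surj[OF assms(1)] by (simp add: surj_image_vimage_eq)
  qed
  then show ?thesis
    by (simp add: carrier_poly_ring)
qed

lemma permute_power_sum:
  assumes "\<sigma> permutes {1..n+1}"
  shows "permute \<sigma> (power_sum n k) = power_sum n k"
proof -
  have "permute \<sigma> (power_sum n k) = (\<Sum>i=1..n+1. X (\<sigma> i) ^ k)"
    by (simp only: power_sum_def permute_sum[OF assms] permute_power[OF assms] permute_X[OF assms])
  also have "\<dots> = power_sum n k"
    unfolding power_sum_def by (rule sum.permute[OF assms, symmetric, unfolded comp_def])
  finally show ?thesis .
qed

section \<open>Classes modulo the first power sum\<close>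

text \<open>
  The elements of the quotient ring, with the ideal written out.
\<close>

definition coset :: "nat \<Rightarrow> mpoly \<Rightarrow> mpoly set" where
  "coset n f = {f + power_sum n 1 * h | h. h \<in> carrier (poly_ring n)}"

lemma carrier_quot_ring: "carrier (quot_ring n) = coset n ` carrier (poly_ring n)"
proof -
  have "PIdl\<^bsub>poly_ring n\<^esub> (power_sum n 1) +>\<^bsub>poly_ring n\<^esub> f = coset n f" for f
    unfolding a_r_coset_def' cgenideal_def coset_def by (auto simp: mult.commute add.commute)
  then show ?thesis
    by (auto simp: quot_ring_def FactRing_def A_RCOSETS_def')
qed

lemma mem_coset_self: "f \<in> coset n f"
  unfolding coset_def using poly_ring_simps(5) by force

lemma coset_eq:
  assumes "g \<in> coset n f"
  shows "coset n g = coset n f"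
proof -
  obtain h where h: "g = f + power_sum n 1 * h" "h \<in> carrier (poly_ring n)"
    using assms by (auto simp: coset_def)
  show ?thesis
  proof (intro equalityI subsetI)
    fix e assume "e \<in> coset n g"
    then obtain k where "e = g + power_sum n 1 * k" "k \<in> carrier (poly_ring n)"
      by (auto simp: coset_def)
    then show "e \<in> coset n f"
      unfolding coset_def using h by (auto intro!: exI[of _ "h + k"] closed simp: distrib_left)
  next
    fix e assume "e \<in> coset n f"
    then obtain k where "e = f + power_sum n 1 * k" "k \<in> carrier (poly_ring n)"
      by (auto simp: coset_def)
    then show "e \<in> coset n g"
      unfolding coset_def using h by (auto intro!: exI[of _ "k - h"] closed simp: algebra_simps)
  qed
qed

lemma eval_coset:
  assumes "g \<in> coset n f" "(\<Sum>i=1..n+1. a i) = 0"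
  shows "eval_poly a g = eval_poly a f"
  using assms by (auto simp: coset_def eval_power_sum)

section \<open>Invariant quartics are spanned by two power sum expressions\<close>

lemma monom_degree_superset:
  assumes "finite S" "Poly_Mapping.keys m \<subseteq> S"
  shows "monom_degree m = (\<Sum>i\<in>S. Poly_Mapping.lookup m i)"
  using assms by (intro sum.mono_neutral_left) (auto simp: in_keys_iff)

lemma monom_degree_add: "monom_degree (l + m) = monom_degree l + monom_degree m"
proof -
  let ?S = "Poly_Mapping.keys l \<union> Poly_Mapping.keys m"
  have "monom_degree (l + m) = (\<Sum>i\<in>?S. Poly_Mapping.lookup (l + m) i)"
    by (intro monom_degree_superset) (simp_all add: keys_add)
  also have "\<dots> = (\<Sum>i\<in>?S. Poly_Mapping.lookup l i) + (\<Sum>i\<in>?S. Poly_Mapping.lookup m i)"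
    by (simp add: lookup_add sum.distrib)
  also have "\<dots> = monom_degree l + monom_degree m"
    by (subst (1 2) monom_degree_superset[of ?S]) simp_all
  finally show ?thesis .
qed

lemma monom_degree_0: "monom_degree m = 0 \<Longrightarrow> m = 0"
  by (metis finite_keys in_keys_iff keys_eq_empty sum_eq_0_iff subsetI subset_empty)

lemma monom_degree_Suc:
  assumes "monom_degree m = Suc d"
  obtains i m' where "m = Poly_Mapping.single i 1 + m'" "i \<in> Poly_Mapping.keys m"
    "monom_degree m' = d" "Poly_Mapping.keys m' \<subseteq> Poly_Mapping.keys m"
proof -
  have "Poly_Mapping.keys m \<noteq> {}"
    using assms by auto
  then obtain i where i: "i \<in> Poly_Mapping.keys m"
    by blast
  define m' where "m' = m - Poly_Mapping.single i 1"
  have m: "m = Poly_Mapping.single i 1 + m'"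
    using i by (intro poly_mapping_eqI)
      (auto simp: m'_def lookup_add lookup_minus lookup_single when_def in_keys_iff)
  moreover have "monom_degree m' = d"
    using assms unfolding m by (subst (asm) monom_degree_add) simp
  moreover have "Poly_Mapping.keys m' \<subseteq> Poly_Mapping.keys m"
    by (auto simp: m'_def in_keys_iff lookup_minus)
  ultimately show ?thesis
    using that i by blast
qed

lemma single_Suc: "Poly_Mapping.single (Poly_Mapping.single i 1 + m) c = X i * Poly_Mapping.single m c"
  by (simp add: X_def mult_single)

lemma single_degree_4:
  assumes "monom_degree m = 4"
  obtains i j k l where "{i, j, k, l} \<subseteq> Poly_Mapping.keys m"
    "Poly_Mapping.single m c = Const c * (X i * X j * X k * X l)"
proof -
  obtain i m1 where 1: "m = Poly_Mapping.single i 1 + m1" "i \<in> Poly_Mapping.keys m"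
    "monom_degree m1 = 3" "Poly_Mapping.keys m1 \<subseteq> Poly_Mapping.keys m"
    using monom_degree_Suc[of m 3] assms by auto
  obtain j m2 where 2: "m1 = Poly_Mapping.single j 1 + m2" "j \<in> Poly_Mapping.keys m1"
    "monom_degree m2 = 2" "Poly_Mapping.keys m2 \<subseteq> Poly_Mapping.keys m1"
    using monom_degree_Suc[of m1 2] 1 by auto
  obtain k m3 where 3: "m2 = Poly_Mapping.single k 1 + m3" "k \<in> Poly_Mapping.keys m2"
    "monom_degree m3 = 1" "Poly_Mapping.keys m3 \<subseteq> Poly_Mapping.keys m2"
    using monom_degree_Suc[of m2 1] 2 by auto
  obtain l m4 where 4: "m3 = Poly_Mapping.single l 1 + m4" "l \<in> Poly_Mapping.keys m3"
    "monom_degree m4 = 0" "Poly_Mapping.keys m4 \<subseteq> Poly_Mapping.keys m3"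
    using monom_degree_Suc[of m3 0] 3 by auto
  have m4: "m4 = 0"
    using 4(3) by (rule monom_degree_0)
  show ?thesis
  proof (rule that[of i j k l])
    show "{i, j, k, l} \<subseteq> Poly_Mapping.keys m"
      using 1 2 3 4 by blast
    show "Poly_Mapping.single m c = Const c * (X i * X j * X k * X l)"
      unfolding 1(1) 2(1) 3(1) 4(1) single_Suc m4 by (simp add: mult_ac)
  qed
qed

text \<open>
  The representatives of the span of the classes of \<open>p\<^sub>4\<close> and \<open>p\<^sub>2\<^sup>2\<close>. The remainder of this section shows
  that the symmetrization of every quartic monomial lies here.
\<close>

definition quartic_space :: "nat \<Rightarrow> mpoly set" where
  "quartic_space n = {Const a * power_sum n 4 + Const b * power_sum n 2 ^ 2 + power_sum n 1 * h
     | a b h. h \<in> carrier (poly_ring n)}"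

lemma quartic_spaceI:
  "h \<in> carrier (poly_ring n) \<Longrightarrow>
    Const a * power_sum n 4 + Const b * power_sum n 2 ^ 2 + power_sum n 1 * h \<in> quartic_space n"
  unfolding quartic_space_def by blast

lemma quartic_spaceE:
  assumes "f \<in> quartic_space n"
  obtains a b h where "h \<in> carrier (poly_ring n)"
    "f = Const a * power_sum n 4 + Const b * power_sum n 2 ^ 2 + power_sum n 1 * h"
  using assms unfolding quartic_space_def by blast

lemma quartic_space_generators:
  "power_sum n 4 \<in> quartic_space n" "power_sum n 2 ^ 2 \<in> quartic_space n"
  "h \<in> carrier (poly_ring n) \<Longrightarrow> power_sum n 1 * h \<in> quartic_space n"
  using quartic_spaceI[of 0 n 1 0] quartic_spaceI[of 0 n 0 1] quartic_spaceI[of h n 0 0]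
  by (simp_all add: Const_hom)

lemma quartic_space_add:
  assumes "f \<in> quartic_space n" "g \<in> quartic_space n"
  shows "f + g \<in> quartic_space n"
proof -
  obtain a b h where f: "h \<in> carrier (poly_ring n)"
    "f = Const a * power_sum n 4 + Const b * power_sum n 2 ^ 2 + power_sum n 1 * h"
    using assms(1) by (rule quartic_spaceE)
  obtain a' b' h' where g: "h' \<in> carrier (poly_ring n)"
    "g = Const a' * power_sum n 4 + Const b' * power_sum n 2 ^ 2 + power_sum n 1 * h'"
    using assms(2) by (rule quartic_spaceE)
  have "f + g = Const (a + a') * power_sum n 4 + Const (b + b') * power_sum n 2 ^ 2
      + power_sum n 1 * (h + h')"
    unfolding f g Const_hom by (simp only: algebra_simps)
  then show ?thesis
    using quartic_spaceI[of "h + h'" n] f g by (simp add: closed)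
qed

lemma quartic_space_scale:
  assumes "f \<in> quartic_space n"
  shows "Const c * f \<in> quartic_space n"
proof -
  obtain a b h where f: "h \<in> carrier (poly_ring n)"
    "f = Const a * power_sum n 4 + Const b * power_sum n 2 ^ 2 + power_sum n 1 * h"
    using assms(1) by (rule quartic_spaceE)
  have "Const c * f = Const (c * a) * power_sum n 4 + Const (c * b) * power_sum n 2 ^ 2
      + power_sum n 1 * (Const c * h)"
    unfolding f Const_hom by (simp only: algebra_simps)
  then show ?thesis
    using quartic_spaceI[of "Const c * h" n] f by (simp add: closed)
qed

text \<open>
  The Reynolds operator, without the division by the group order.
\<close>

definition symmetrize :: "nat \<Rightarrow> mpoly \<Rightarrow> mpoly" where
  "symmetrize n f = (\<Sum>\<sigma> | \<sigma> permutes {1..n+1}. permute \<sigma> f)"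

lemma symmetrize_add: "symmetrize n (f + g) = symmetrize n f + symmetrize n g"
  by (simp add: symmetrize_def permute_add sum.distrib)

lemma symmetrize_invariant_mult:
  assumes "\<And>\<sigma>. \<sigma> permutes {1..n+1} \<Longrightarrow> permute \<sigma> p = p"
  shows "symmetrize n (p * f) = p * symmetrize n f"
  unfolding symmetrize_def sum_distrib_left
  by (rule sum.cong) (simp_all add: permute_mult[of _ "{1..n+1}"] assms del: One_nat_def)

lemma symmetrize_Const_mult: "symmetrize n (Const c * f) = Const c * symmetrize n f"
  by (rule symmetrize_invariant_mult) (rule permute_Const)

lemma symmetrize_invariant:
  assumes "\<And>\<sigma>. \<sigma> permutes {1..n+1} \<Longrightarrow> permute \<sigma> p = p"
  shows "symmetrize n p = Const (fact (n + 1)) * p"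
proof -
  have "symmetrize n p = (\<Sum>\<sigma> | \<sigma> permutes {1..n+1}. p)"
    unfolding symmetrize_def by (rule sum.cong) (simp_all add: assms del: One_nat_def)
  also have "\<dots> = of_nat (card {\<sigma>. \<sigma> permutes {1..n+1}}) * p"
    by simp
  also have "card {\<sigma>. \<sigma> permutes {1..n+1}} = fact (n + 1)"
    by (intro card_permutations) simp_all
  finally show ?thesis
    by (simp flip: Const_of_nat del: single_of_nat fact_Suc)
qed

lemma symmetrize_permute:
  assumes "\<tau> permutes {1..n+1}"
  shows "symmetrize n (permute \<tau> f) = symmetrize n f"
proof -
  have "symmetrize n (permute \<tau> f) = (\<Sum>\<sigma> | \<sigma> permutes {1..n+1}. permute (\<sigma> \<circ> \<tau>) f)"
    unfolding symmetrize_def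
    by (rule sum.cong) (simp_all add: permute_permute[OF _ assms] del: One_nat_def)
  also have "\<dots> = symmetrize n f"
    unfolding symmetrize_def by (rule sum_permutations_compose_right[OF assms, symmetric])
  finally show ?thesis .
qed

definition symmetrizable :: "nat \<Rightarrow> mpoly set" where
  "symmetrizable n = {f. symmetrize n f \<in> quartic_space n}"

lemma symmetrizable_add:
  "f \<in> symmetrizable n \<Longrightarrow> g \<in> symmetrizable n \<Longrightarrow> f + g \<in> symmetrizable n"
  by (simp add: symmetrizable_def symmetrize_add quartic_space_add)

lemma symmetrizable_scale: "f \<in> symmetrizable n \<Longrightarrow> Const c * f \<in> symmetrizable n"
  by (simp add: symmetrizable_def symmetrize_Const_mult quartic_space_scale)

lemma symmetrizable_diff:
  assumes "f \<in> symmetrizable n" "g \<in> symmetrizable n"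
  shows "f - g \<in> symmetrizable n"
  using symmetrizable_add[OF assms(1) symmetrizable_scale[OF assms(2), of "-1"]]
  by (simp only: Const_hom) simp

lemma symmetrizable_0: "0 \<in> symmetrizable n"
  using quartic_space_generators(3)[of 0 n]
  by (simp add: symmetrizable_def symmetrize_def permute_0)

lemma symmetrizable_sum:
  "(\<And>i. i \<in> S \<Longrightarrow> f i \<in> symmetrizable n) \<Longrightarrow> sum f S \<in> symmetrizable n"
  by (induction S rule: infinite_finite_induct) (simp_all add: symmetrizable_0 symmetrizable_add)

lemma symmetrizable_generators:
  "power_sum n 4 \<in> symmetrizable n" "power_sum n 2 ^ 2 \<in> symmetrizable n"
proof -
  have "symmetrize n (power_sum n 4) = Const (fact (n + 1)) * power_sum n 4"
    by (rule symmetrize_invariant) (rule permute_power_sum)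
  then show "power_sum n 4 \<in> symmetrizable n"
    by (simp add: symmetrizable_def quartic_space_generators quartic_space_scale)
  have "symmetrize n (power_sum n 2 ^ 2) = Const (fact (n + 1)) * power_sum n 2 ^ 2"
    by (rule symmetrize_invariant) (simp add: permute_power[of _ "{1..n+1}"] permute_power_sum del: One_nat_def)
  then show "power_sum n 2 ^ 2 \<in> symmetrizable n"
    by (simp add: symmetrizable_def quartic_space_generators quartic_space_scale)
qed

lemma symmetrizable_ideal:
  assumes "h \<in> carrier (poly_ring n)"
  shows "h * power_sum n 1 \<in> symmetrizable n"
proof -
  have "symmetrize n (power_sum n 1 * h) = power_sum n 1 * symmetrize n h"
    by (rule symmetrize_invariant_mult) (rule permute_power_sum)
  moreover have "symmetrize n h \<in> carrier (poly_ring n)"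
    unfolding symmetrize_def using assms by (intro sum_closed permute_closed) auto
  ultimately show ?thesis
    using quartic_space_generators(3) by (simp add: symmetrizable_def mult.commute)
qed

text \<open>
  Symmetrization forgets which index of \<open>J\<close> occurs, as long as the transpositions of these indices fix
  the other factor. So a single term is known once the sum over the free index is known, and that sum is a
  power sum up to monomials with more coincidences among their indices.
\<close>

lemma symmetrizable_average:
  assumes J: "J \<subseteq> {1..n+1}" "j \<in> J"
    and M: "\<And>k. k \<in> J \<Longrightarrow> permute (transpose j k) M = M"
    and sum: "(\<Sum>k\<in>J. M * X k ^ e) \<in> symmetrizable n"
  shows "M * X j ^ e \<in> symmetrizable n"
proof -
  have fin: "finite J"
    using J(1) finite_subset by blast
  have "symmetrize n (M * X k ^ e) = symmetrize n (M * X j ^ e)" if "k \<in> J" for k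
  proof -
    have tr: "transpose j k permutes {1..n+1}"
      using J that by (intro permutes_swap_id) auto
    have "permute (transpose j k) (M * X j ^ e) = M * X k ^ e"
      by (simp only: permute_mult[OF tr] permute_power[OF tr] permute_X[OF tr] M[OF that] transpose_apply_first)
    then show ?thesis
      using symmetrize_permute[OF tr] by metis
  qed
  moreover have "symmetrize n (\<Sum>k\<in>S. M * X k ^ e) = (\<Sum>k\<in>S. symmetrize n (M * X k ^ e))"
    if "finite S" for S
    using that by induction (simp_all add: symmetrize_add, simp add: symmetrize_def permute_0)
  ultimately have "symmetrize n (\<Sum>k\<in>J. M * X k ^ e) = of_nat (card J) * symmetrize n (M * X j ^ e)"
    using fin by simp
  also have "\<dots> = Const (card J) * symmetrize n (M * X j ^ e)"
    by simp
  finally have "Const (1 / card J) * symmetrize n (\<Sum>k\<in>J. M * X k ^ e)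
      = Const (1 / card J * card J) * symmetrize n (M * X j ^ e)"
    by (simp only: Const_hom(4) mult.assoc)
  moreover have "1 / real (card J) * card J = 1"
    using J(2) fin card_gt_0_iff[of J] by auto
  ultimately have "symmetrize n (M * X j ^ e) = Const (1 / card J) * symmetrize n (\<Sum>k\<in>J. M * X k ^ e)"
    by (simp only: Const_hom mult_1_left)
  then show ?thesis
    using sum quartic_space_scale by (simp add: symmetrizable_def)
qed

text \<open>
  Summing over the last index reduces each exponent pattern to the ones treated before it, in the
  order \<open>4\<close>, then \<open>2+2\<close> and \<open>3+1\<close>, then \<open>2+1+1\<close>, then \<open>1+1+1+1\<close>. The complete sum over an index
  occurring to the first power is a multiple of \<open>p\<^sub>1\<close>; for \<open>2+2\<close> it is a multiple of \<open>p\<^sub>2\<close>, which is averaged once more.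
\<close>

lemma symmetrizable_quartic_monomials:
  fixes i j k l :: nat
  assumes "{i, j, k, l} \<subseteq> {1..n+1}"
  shows "X i * X j * X k * X l \<in> symmetrizable n"
proof -
  define A where "A = {1..n+1}"
  have A: "finite A" "i \<in> A" "j \<in> A" "k \<in> A" "l \<in> A"
    using assms by (auto simp: A_def)
  have tr: "transpose a b permutes A" if "a \<in> A" "b \<in> A" for a b
    using that by (rule permutes_swap_id)
  have permute_other: "permute (transpose a b) (X c) = X c" if "a \<in> A" "b \<in> A" "c \<noteq> a" "c \<noteq> b" for a b c
    using that by (simp add: permute_X[OF tr])
  have ps: "power_sum n e = (\<Sum>c\<in>A. X c ^ e)" for e
    by (simp add: power_sum_def A_def)
  have sub: "(\<Sum>c\<in>A - S. f c) = (\<Sum>c\<in>A. f c) - sum f S" if "S \<subseteq> A" for S and f :: "nat \<Rightarrow> mpoly"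
    using that A(1) by (rule sum_diff[rotated])
  note avg = symmetrizable_average[of _ n, folded A_def]
  note cl = closed X_closed[of _ n, folded A_def]
  have four: "X a ^ 4 \<in> symmetrizable n" if "a \<in> A" for a
    using avg[of A a 1 4] that tr symmetrizable_generators(1)[of n]
    by (simp add: permute_1[OF tr] ps)
  have "power_sum n 2 * X a ^ 2 \<in> symmetrizable n" if "a \<in> A" for a
  proof (rule avg[of A])
    show "permute (transpose a b) (power_sum n 2) = power_sum n 2" if "b \<in> A" for b
      using permute_power_sum[OF tr[OF \<open>a \<in> A\<close> that, unfolded A_def]] .
    show "(\<Sum>b\<in>A. power_sum n 2 * X b ^ 2) \<in> symmetrizable n"
      using symmetrizable_generators(2)[of n] by (simp add: power2_eq_square ps sum_distrib_left)
  qed (use that in auto)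
  then have two_two': "X a ^ 2 * power_sum n 2 \<in> symmetrizable n" if "a \<in> A" for a
    using that by (simp add: mult.commute)
  have two_two: "X a ^ 2 * X b ^ 2 \<in> symmetrizable n" if "a \<in> A" "b \<in> A" "a \<noteq> b" for a b
  proof (rule avg[of "A - {a}"])
    show "permute (transpose b c) (X a ^ 2) = X a ^ 2" if "c \<in> A - {a}" for c
      using that \<open>b \<in> A\<close> \<open>a \<noteq> b\<close> by (simp add: permute_power[OF tr] permute_other)
    have "(\<Sum>c\<in>A - {a}. X a ^ 2 * X c ^ 2) = X a ^ 2 * power_sum n 2 - X a ^ 4"
      using that by (simp add: sub ps sum_distrib_left flip: power_add)
    then show "(\<Sum>c\<in>A - {a}. X a ^ 2 * X c ^ 2) \<in> symmetrizable n"
      using that by (simp add: symmetrizable_diff two_two' four)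
  qed (use that in auto)
  have three_one: "X a ^ 3 * X b ^ 1 \<in> symmetrizable n" if "a \<in> A" "b \<in> A" "a \<noteq> b" for a b
  proof (rule avg[of "A - {a}"])
    show "permute (transpose b c) (X a ^ 3) = X a ^ 3" if "c \<in> A - {a}" for c
      using that \<open>b \<in> A\<close> \<open>a \<noteq> b\<close> by (simp add: permute_power[OF tr] permute_other)
    have "(\<Sum>c\<in>A - {a}. X a ^ 3 * X c ^ 1) = X a ^ 3 * power_sum n 1 - X a ^ 4"
      using that by (simp add: sub ps sum_distrib_left flip: power_Suc2)
    then show "(\<Sum>c\<in>A - {a}. X a ^ 3 * X c ^ 1) \<in> symmetrizable n"
      using that by (simp only: symmetrizable_diff symmetrizable_ideal four cl)
  qed (use that in auto)
  have two_one_one: "(X a ^ 2 * X b) * X c ^ 1 \<in> symmetrizable n"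
    if "a \<in> A" "b \<in> A" "c \<in> A" "a \<noteq> b" "a \<noteq> c" "b \<noteq> c" for a b c
  proof (rule avg[of "A - {a, b}"])
    show "permute (transpose c d) (X a ^ 2 * X b) = X a ^ 2 * X b" if "d \<in> A - {a, b}" for d
      using that \<open>c \<in> A\<close> \<open>a \<noteq> c\<close> \<open>b \<noteq> c\<close> by (simp add: permute_mult[OF tr] permute_power[OF tr] permute_other)
    have "(\<Sum>d\<in>A - {a, b}. X a ^ 2 * X b * X d ^ 1)
        = X a ^ 2 * X b * power_sum n 1 - X a ^ 3 * X b ^ 1 - X a ^ 2 * X b ^ 2"
      using that by (simp add: sub ps sum_distrib_left power_numeral_reduce algebra_simps)
    then show "(\<Sum>d\<in>A - {a, b}. X a ^ 2 * X b * X d ^ 1) \<in> symmetrizable n"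
      using that by (simp only: symmetrizable_diff symmetrizable_ideal three_one two_two cl not_False_eq_True)
  qed (use that in auto)
  have ones: "(X a * X b * X c) * X d ^ 1 \<in> symmetrizable n"
    if "a \<in> A" "b \<in> A" "c \<in> A" "d \<in> A" "a \<noteq> b" "a \<noteq> c" "b \<noteq> c" "a \<noteq> d" "b \<noteq> d" "c \<noteq> d" for a b c d
  proof (rule avg[of "A - {a, b, c}"])
    show "permute (transpose d e) (X a * X b * X c) = X a * X b * X c" if "e \<in> A - {a, b, c}" for e
      using that \<open>d \<in> A\<close> \<open>a \<noteq> d\<close> \<open>b \<noteq> d\<close> \<open>c \<noteq> d\<close> by (simp add: permute_mult[OF tr] permute_other)
    have "(\<Sum>e\<in>A - {a, b, c}. X a * X b * X c * X e ^ 1)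
        = X a * X b * X c * power_sum n 1 - X a ^ 2 * X b * X c ^ 1 - X b ^ 2 * X a * X c ^ 1
          - X c ^ 2 * X a * X b ^ 1"
      using that by (simp add: sub ps sum_distrib_left power_numeral_reduce algebra_simps)
    then show "(\<Sum>e\<in>A - {a, b, c}. X a * X b * X c * X e ^ 1) \<in> symmetrizable n"
      using that by (simp only: symmetrizable_diff symmetrizable_ideal two_one_one cl not_False_eq_True)
  qed (use that in auto)
  have P4: "x * x * x * x = x ^ 4" and P31: "x * x * x * y = x ^ 3 * y ^ 1" "x * x * y * x = x ^ 3 * y ^ 1"
      "x * y * x * x = x ^ 3 * y ^ 1" "y * x * x * x = x ^ 3 * y ^ 1"
    and P22: "x * x * y * y = x ^ 2 * y ^ 2" "x * y * x * y = x ^ 2 * y ^ 2" "x * y * y * x = x ^ 2 * y ^ 2"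
    and P211: "x * x * y * z = x ^ 2 * y * z ^ 1" "x * y * x * z = x ^ 2 * y * z ^ 1"
      "x * y * z * x = x ^ 2 * y * z ^ 1" "y * x * x * z = x ^ 2 * y * z ^ 1"
      "y * x * z * x = x ^ 2 * y * z ^ 1" "y * z * x * x = x ^ 2 * y * z ^ 1"
    for x y z :: mpoly
    by (simp_all add: power_numeral_reduce algebra_simps)
  consider "i = j" "i = k" "i = l"
    | "i = j" "i = k" "i \<noteq> l" | "i = j" "i = l" "i \<noteq> k" | "i = k" "i = l" "i \<noteq> j" | "j = k" "j = l" "i \<noteq> j"
    | "i = j" "k = l" "i \<noteq> k" | "i = k" "j = l" "i \<noteq> j" | "i = l" "j = k" "i \<noteq> j"
    | "i = j" "i \<noteq> k" "i \<noteq> l" "k \<noteq> l" | "i = k" "i \<noteq> j" "i \<noteq> l" "j \<noteq> l" | "i = l" "i \<noteq> j" "i \<noteq> k" "j \<noteq> k"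
    | "j = k" "i \<noteq> j" "i \<noteq> l" "j \<noteq> l" | "j = l" "i \<noteq> j" "i \<noteq> k" "j \<noteq> k" | "k = l" "i \<noteq> j" "i \<noteq> k" "j \<noteq> k"
    | "i \<noteq> j" "i \<noteq> k" "i \<noteq> l" "j \<noteq> k" "j \<noteq> l" "k \<noteq> l"
    by argo
  then show ?thesis
  proof cases
    case 1 then show ?thesis using A four by (simp only: P4)
  next
    case 2 then show ?thesis using A three_one[of i l] by (simp only: P31 simp_thms)
  next
    case 3 then show ?thesis using A three_one[of i k] by (simp only: P31 simp_thms)
  next
    case 4 then show ?thesis using A three_one[of i j] by (simp only: P31 simp_thms)
  next
    case 5 then show ?thesis using A three_one[of j i] by (simp only: P31 simp_thms)
  next
    case 6 then show ?thesis using A two_two[of i k] by (simp only: P22 simp_thms)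
  next
    case 7 then show ?thesis using A two_two[of i j] by (simp only: P22 simp_thms)
  next
    case 8 then show ?thesis using A two_two[of i j] by (simp only: P22 simp_thms)
  next
    case 9 then show ?thesis using A two_one_one[of i k l] by (simp only: P211 simp_thms)
  next
    case 10 then show ?thesis using A two_one_one[of i j l] by (simp only: P211 simp_thms)
  next
    case 11 then show ?thesis using A two_one_one[of i j k] by (simp only: P211 simp_thms)
  next
    case 12 then show ?thesis using A two_one_one[of j i l] by (simp only: P211 simp_thms)
  next
    case 13 then show ?thesis using A two_one_one[of j i k] by (simp only: P211 simp_thms)
  next
    case 14 then show ?thesis using A two_one_one[of k i j] by (simp only: P211 simp_thms)
  next
    case 15 then show ?thesis using A ones[of i j k l] by simp
  qed
qed

lemma homogeneous_quartic_symmetrizable: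
  assumes "f \<in> carrier (poly_ring n)" "homogeneous 4 f"
  shows "f \<in> symmetrizable n"
proof -
  have "Poly_Mapping.single m (Poly_Mapping.lookup f m) \<in> symmetrizable n"
    if m: "m \<in> Poly_Mapping.keys f" for m
  proof -
    have "monom_degree m = 4"
      using assms(2) m unfolding homogeneous_def by blast
    then obtain i j k l where ijkl: "{i, j, k, l} \<subseteq> Poly_Mapping.keys m"
      "Poly_Mapping.single m (Poly_Mapping.lookup f m)
        = Const (Poly_Mapping.lookup f m) * (X i * X j * X k * X l)"
      by (rule single_degree_4)
    have "Poly_Mapping.keys m \<subseteq> {1..n+1}"
      using assms(1) m unfolding carrier_poly_ring by blast
    then have "{i, j, k, l} \<subseteq> {1..n+1}"
      using ijkl(1) by (rule subset_trans[rotated])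
    then show ?thesis
      unfolding ijkl(2) by (intro symmetrizable_scale symmetrizable_quartic_monomials)
  qed
  then show ?thesis
    by (subst mpoly_expand) (rule symmetrizable_sum)
qed

lemma coset_closed:
  assumes "f \<in> carrier (poly_ring n)" "g \<in> coset n f"
  shows "g \<in> carrier (poly_ring n)"
  using assms unfolding coset_def by (auto intro!: closed)

text \<open>
  All images of a homogeneous representative under the group lie in the same class, so its
  symmetrization represents that class up to the factor \<open>N!\<close>, and this factor is invertible.
\<close>

lemma invariant_quartic_representative:
  assumes "C \<in> invariant_quartics n"
  obtains a b where "C = coset n (Const a * power_sum n 4 + Const b * power_sum n 2 ^ 2)"
proof -
  obtain f0 where f0: "C = coset n f0" "f0 \<in> carrier (poly_ring n)"
    using assms by (auto simp: invariant_quartics_def carrier_quot_ring)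
  obtain f where f: "f \<in> C" "homogeneous 4 f"
    using assms by (auto simp: invariant_quartics_def)
  have fR: "f \<in> carrier (poly_ring n)" and C: "C = coset n f"
    using f f0 coset_closed coset_eq by blast+
  have "\<exists>h\<in>carrier (poly_ring n). permute \<sigma> f = f + power_sum n 1 * h"
    if "\<sigma> permutes {1..n+1}" for \<sigma>
  proof -
    have "permute \<sigma> f \<in> C"
      using assms that f(1) unfolding invariant_quartics_def by blast
    then show ?thesis
      unfolding C coset_def by blast
  qed
  then obtain h where h: "\<And>\<sigma>. \<sigma> permutes {1..n+1} \<Longrightarrow> h \<sigma> \<in> carrier (poly_ring n)"
      "\<And>\<sigma>. \<sigma> permutes {1..n+1} \<Longrightarrow> permute \<sigma> f = f + power_sum n 1 * h \<sigma>"
    by metis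
  define H where "H = (\<Sum>\<sigma> | \<sigma> permutes {1..n+1}. h \<sigma>)"
  have H: "H \<in> carrier (poly_ring n)"
    unfolding H_def by (rule sum_closed) (use h(1) in blast)
  have "symmetrize n f = (\<Sum>\<sigma> | \<sigma> permutes {1..n+1}. f + power_sum n 1 * h \<sigma>)"
    unfolding symmetrize_def by (rule sum.cong) (use h(2) in auto)
  also have "\<dots> = of_nat (card {\<sigma>. \<sigma> permutes {1..n+1}}) * f + power_sum n 1 * H"
    by (simp only: H_def sum.distrib sum_distrib_left sum_constant)
  also have "card {\<sigma>. \<sigma> permutes {1..n+1}} = fact (n + 1)"
    by (intro card_permutations) simp_all
  finally have "symmetrize n f = of_nat (fact (n + 1)) * f + power_sum n 1 * H" .
  then have eq1: "symmetrize n f = Const (fact (n + 1)) * f + power_sum n 1 * H"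
    by (simp flip: Const_of_nat del: single_of_nat fact_Suc)
  have "symmetrize n f \<in> quartic_space n"
    using homogeneous_quartic_symmetrizable[OF fR f(2)] by (simp add: symmetrizable_def)
  then obtain a b k where k: "k \<in> carrier (poly_ring n)"
    "symmetrize n f = Const a * power_sum n 4 + Const b * power_sum n 2 ^ 2 + power_sum n 1 * k"
    by (rule quartic_spaceE)
  define c :: real where "c = 1 / fact (n + 1)"
  have c: "c * fact (n + 1) = 1"
    by (simp add: c_def del: fact_Suc)
  have "f = Const (c * fact (n + 1)) * f"
    unfolding c by (simp only: Const_hom mult_1_left)
  also have "\<dots> = Const c * (symmetrize n f - power_sum n 1 * H)"
    unfolding eq1 Const_hom by (simp only: algebra_simps)
  also have "\<dots> = Const (c * a) * power_sum n 4 + Const (c * b) * power_sum n 2 ^ 2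
      + power_sum n 1 * (Const c * (k - H))"
    unfolding k(2) Const_hom by (simp only: algebra_simps)
  finally have "f \<in> coset n (Const (c * a) * power_sum n 4 + Const (c * b) * power_sum n 2 ^ 2)"
    unfolding coset_def using closed(2)[OF closed(4) closed(8)[OF k(1) H]] by blast
  then show ?thesis
    using that coset_eq[of f] C by metis
qed

section \<open>Two families of squares\<close>

lemma sum_square_differences:
  fixes x :: "'i \<Rightarrow> 'a::comm_ring_1"
  shows "(\<Sum>i\<in>A. \<Sum>j\<in>A. (x i ^ 2 - x j ^ 2) ^ 2)
    = 2 * (of_nat (card A) * (\<Sum>i\<in>A. x i ^ 4) - (\<Sum>i\<in>A. x i ^ 2) ^ 2)"
proof -
  have expand: "(x i ^ 2 - x j ^ 2) ^ 2 = x i ^ 4 + x j ^ 4 - 2 * (x i ^ 2 * x j ^ 2)" for i j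
    by (simp add: power_numeral_reduce algebra_simps)
  have "(\<Sum>i\<in>A. \<Sum>j\<in>A. x i ^ 2 * x j ^ 2) = (\<Sum>i\<in>A. x i ^ 2) ^ 2"
    by (simp add: power2_eq_square[of "sum _ _"] sum_product)
  then show ?thesis
    unfolding expand
    by (simp add: sum.distrib sum_subtractf right_diff_distrib flip: sum_distrib_left)
qed

text \<open>
  For real variables, the summand is a scalar multiple of the component of \<open>(x\<^sub>i - x\<^sub>j)\<^sup>2\<close> in the irreducible
  representation of type \<open>(N - 2, 2)\<close>: up to that scalar it is \<open>(x\<^sub>i - x\<^sub>j)\<^sup>2\<close> corrected by multiples of
  \<open>x\<^sub>i\<^sup>2 + x\<^sub>j\<^sup>2\<close> and \<open>p\<^sub>2\<close> such that, modulo \<open>p\<^sub>1\<close>, the sum over all \<open>j\<close> different from \<open>i\<close> vanishes. At a vertex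
  \<open>(N - 1, -1, \<dots>, -1)\<close> every summand is zero, which is why the result is the quartic that vanishes there.
\<close>

lemma sum_squares_two_index:
  fixes x :: "'i \<Rightarrow> 'a::comm_ring_1"
  assumes "finite A"
  defines "N \<equiv> of_nat (card A) :: 'a" and "s \<equiv> \<lambda>k. \<Sum>i\<in>A. x i ^ k"
  shows "(\<Sum>i\<in>A. \<Sum>j\<in>A - {i}.
      (s 2 - (N - 1) * (x i ^ 2 + x j ^ 2) - (N - 1) * (N - 2) * (x i * x j)) ^ 2)
    = (N - 1) * (N - 2) * ((N ^ 2 - 3 * N + 3) * s 2 ^ 2 - N * (N - 1) * s 4)
      + s 1 * (4 * (N - 1) ^ 2 * (N - 2) * s 3 - 2 * (N - 1) * (N - 2) * s 2 * s 1)"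
proof -
  define c e where "c = N - 1" and "e = N - 2"
  define v where "v i j = s 2 - c * (x i ^ 2 + x j ^ 2) - c * e * (x i * x j)" for i j
  have prod: "(\<Sum>i\<in>A. \<Sum>j\<in>A. x i ^ k * x j ^ l) = s k * s l" for k l
    by (simp add: s_def sum_product)
  have lin: "(\<Sum>i\<in>A. \<Sum>j\<in>A. d * f i j) = d * (\<Sum>i\<in>A. \<Sum>j\<in>A. f i j)"
    for d :: 'a and f
    by (simp add: sum_distrib_left)
  have s0: "s 0 = N"
    by (simp add: s_def N_def)
  have "v i j ^ 2 = s 2 ^ 2 * (x i ^ 0 * x j ^ 0) + c ^ 2 * (x i ^ 4 * x j ^ 0) + c ^ 2 * (x i ^ 0 * x j ^ 4)
      + (2 * c ^ 2 + c ^ 2 * e ^ 2) * (x i ^ 2 * x j ^ 2)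
      + (- 2 * c * s 2) * (x i ^ 2 * x j ^ 0) + (- 2 * c * s 2) * (x i ^ 0 * x j ^ 2)
      + (- 2 * c * e * s 2) * (x i ^ 1 * x j ^ 1)
      + (2 * c ^ 2 * e) * (x i ^ 3 * x j ^ 1) + (2 * c ^ 2 * e) * (x i ^ 1 * x j ^ 3)" for i j
    unfolding v_def by (simp add: power_numeral_reduce algebra_simps)
  then have all: "(\<Sum>i\<in>A. \<Sum>j\<in>A. v i j ^ 2) = s 2 ^ 2 * (s 0 * s 0) + c ^ 2 * (s 4 * s 0) + c ^ 2 * (s 0 * s 4)
      + (2 * c ^ 2 + c ^ 2 * e ^ 2) * (s 2 * s 2)
      + (- 2 * c * s 2) * (s 2 * s 0) + (- 2 * c * s 2) * (s 0 * s 2)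
      + (- 2 * c * e * s 2) * (s 1 * s 1)
      + (2 * c ^ 2 * e) * (s 3 * s 1) + (2 * c ^ 2 * e) * (s 1 * s 3)"
    by (simp only: sum.distrib lin prod)
  have diag: "(\<Sum>i\<in>A. v i i ^ 2) = N * s 2 ^ 2 - 2 * N * c * s 2 ^ 2 + (N * c) ^ 2 * s 4"
  proof -
    have v: "v i i = s 2 - N * c * x i ^ 2" for i
      unfolding v_def c_def e_def by (simp add: power_numeral_reduce algebra_simps)
    have "v i i ^ 2 = s 2 ^ 2 + (- 2 * N * c * s 2) * x i ^ 2 + (N * c) ^ 2 * x i ^ 4" for i
      unfolding v by (simp add: power_numeral_reduce algebra_simps)
    then have "(\<Sum>i\<in>A. v i i ^ 2) = (\<Sum>i\<in>A. s 2 ^ 2) + (- 2 * N * c * s 2) * s 2 + (N * c) ^ 2 * s 4"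
      by (simp only: sum.distrib s_def flip: sum_distrib_left)
    then show ?thesis
      by (simp add: N_def power2_eq_square algebra_simps)
  qed
  have "(\<Sum>j\<in>A - {i}. v i j ^ 2) = (\<Sum>j\<in>A. v i j ^ 2) - v i i ^ 2" if "i \<in> A" for i
    using assms(1) that by (simp add: sum_diff1)
  then have "(\<Sum>i\<in>A. \<Sum>j\<in>A - {i}. v i j ^ 2) = (\<Sum>i\<in>A. \<Sum>j\<in>A. v i j ^ 2) - (\<Sum>i\<in>A. v i i ^ 2)"
    by (simp flip: sum_subtractf)
  also have "\<dots>
    = (N - 1) * (N - 2) * ((N ^ 2 - 3 * N + 3) * s 2 ^ 2 - N * (N - 1) * s 4)
      + s 1 * (4 * (N - 1) ^ 2 * (N - 2) * s 3 - 2 * (N - 1) * (N - 2) * s 2 * s 1)"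
    unfolding all diag s0 c_def e_def by (simp add: power_numeral_reduce algebra_simps)
  finally show ?thesis
    unfolding v_def c_def e_def .
qed

section \<open>The cone of sums of squares\<close>

definition is_sos :: "nat \<Rightarrow> mpoly \<Rightarrow> bool" where
  "is_sos n f \<longleftrightarrow> (\<exists>(l::nat) (g :: nat \<Rightarrow> mpoly) h.
     (\<forall>j \<in> {1..l}. g j \<in> carrier (poly_ring n)) \<and> h \<in> carrier (poly_ring n) \<and>
     f = (\<Sum>j = 1..l. g j ^ 2) + power_sum n 1 * h)"

lemma is_sosE:
  assumes "is_sos n f"
  obtains l g h where "\<forall>j \<in> {1..l::nat}. g j \<in> carrier (poly_ring n)" "h \<in> carrier (poly_ring n)"
    "f = (\<Sum>j = 1..l. g j ^ 2) + power_sum n 1 * h"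
  using assms unfolding is_sos_def by (elim exE conjE) (rule that)

lemma is_sos_ideal: "h \<in> carrier (poly_ring n) \<Longrightarrow> is_sos n (power_sum n 1 * h)"
  unfolding is_sos_def by (intro exI[of _ 0] exI[of _ "\<lambda>_. 0"] exI[of _ h]) simp

lemma is_sos_square: "g \<in> carrier (poly_ring n) \<Longrightarrow> is_sos n (g ^ 2)"
  unfolding is_sos_def by (intro exI[of _ 1] exI[of _ "\<lambda>_. g"] exI[of _ 0]) simp

lemma is_sos_add:
  assumes "is_sos n f" "is_sos n f'"
  shows "is_sos n (f + f')"
proof -
  obtain l g h where f: "\<forall>j \<in> {1..l::nat}. g j \<in> carrier (poly_ring n)" "h \<in> carrier (poly_ring n)"
    "f = (\<Sum>j = 1..l. g j ^ 2) + power_sum n 1 * h"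
    using assms(1) by (rule is_sosE)
  obtain l' g' h' where f': "\<forall>j \<in> {1..l'::nat}. g' j \<in> carrier (poly_ring n)" "h' \<in> carrier (poly_ring n)"
    "f' = (\<Sum>j = 1..l'. g' j ^ 2) + power_sum n 1 * h'"
    using assms(2) by (rule is_sosE)
  define k where "k j = (if j \<le> l then g j else g' (j - l))" for j
  have "(\<Sum>j = 1..l + l'. k j ^ 2) = (\<Sum>j = 1..l. k j ^ 2) + (\<Sum>j = l + 1..l + l'. k j ^ 2)"
    by (rule sum.ub_add_nat) simp
  also have "(\<Sum>j = 1..l. k j ^ 2) = (\<Sum>j = 1..l. g j ^ 2)"
    by (rule sum.cong) (simp_all add: k_def)
  also have "(\<Sum>j = l + 1..l + l'. k j ^ 2) = (\<Sum>j = 1..l'. k (j + l) ^ 2)"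
    using sum.shift_bounds_cl_nat_ivl[of "\<lambda>j. k j ^ 2" 1 l l'] by (simp add: add.commute)
  also have "\<dots> = (\<Sum>j = 1..l'. g' j ^ 2)"
    by (rule sum.cong) (simp_all add: k_def)
  finally have "f + f' = (\<Sum>j = 1..l + l'. k j ^ 2) + power_sum n 1 * (h + h')"
    by (simp add: f f' algebra_simps)
  moreover have "\<forall>j\<in>{1..l + l'}. k j \<in> carrier (poly_ring n)"
  proof
    fix j assume "j \<in> {1..l + l'}"
    then have "j \<in> {1..l} \<or> \<not> j \<le> l \<and> j - l \<in> {1..l'}"
      by auto
    then show "k j \<in> carrier (poly_ring n)"
      using f(1) f'(1) unfolding k_def by auto
  qed
  ultimately show ?thesis
    unfolding is_sos_def using closed(1)[OF f(2) f'(2)] by blast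
qed

lemma is_sos_0: "is_sos n 0"
  using is_sos_ideal[of 0 n] by simp

lemma is_sos_sum: "(\<And>i. i \<in> S \<Longrightarrow> is_sos n (f i)) \<Longrightarrow> is_sos n (sum f S)"
  by (induction S rule: infinite_finite_induct) (simp_all add: is_sos_0 is_sos_add)

lemma is_sos_scale:
  assumes "is_sos n f" "0 \<le> c"
  shows "is_sos n (Const c * f)"
proof -
  obtain l g h where f: "\<forall>j \<in> {1..l::nat}. g j \<in> carrier (poly_ring n)" "h \<in> carrier (poly_ring n)"
    "f = (\<Sum>j = 1..l. g j ^ 2) + power_sum n 1 * h"
    using assms(1) by (rule is_sosE)
  have square: "(Const (sqrt c) * g j) ^ 2 = Const c * g j ^ 2" for j
    using assms(2) by (simp add: power_mult_distrib flip: Const_power)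
  have "Const c * f = (\<Sum>j = 1..l. (Const (sqrt c) * g j) ^ 2) + power_sum n 1 * (Const c * h)"
    unfolding square f(3) by (simp only: distrib_left sum_distrib_left mult.left_commute)
  moreover have "\<forall>j \<in> {1..l}. Const (sqrt c) * g j \<in> carrier (poly_ring n)"
    using f(1) closed(2,4) by blast
  moreover have "Const c * h \<in> carrier (poly_ring n)"
    using f(2) closed(2,4) by blast
  ultimately show ?thesis
    unfolding is_sos_def by (intro exI[of _ l] exI[of _ "\<lambda>j. Const (sqrt c) * g j"] exI) blast
qed

lemma is_sos_lower_ray:
  fixes n :: nat
  defines "N \<equiv> real (n + 1)"
  shows "is_sos n (Const N * power_sum n 4 - power_sum n 2 ^ 2)"
proof -
  have "is_sos n (\<Sum>i\<in>{1..n+1}. \<Sum>j\<in>{1..n+1}. (X i ^ 2 - X j ^ 2) ^ 2)"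
    by (intro is_sos_sum is_sos_square closed)
  also have "(\<Sum>i\<in>{1..n+1}. \<Sum>j\<in>{1..n+1}. (X i ^ 2 - X j ^ 2) ^ 2)
      = 2 * (of_nat (n + 1) * power_sum n 4 - power_sum n 2 ^ 2)"
    by (simp only: sum_square_differences power_sum_def card_atLeastAtMost) simp
  also have "\<dots> = Const 2 * (Const N * power_sum n 4 - power_sum n 2 ^ 2)"
    by (simp only: N_def single_of_nat single_numeral)
  finally have "is_sos n (Const (1/2) * (Const 2 * (Const N * power_sum n 4 - power_sum n 2 ^ 2)))"
    by (rule is_sos_scale) simp
  then show ?thesis
    unfolding mult.assoc[symmetric] Const_hom(4)[symmetric] by simp
qed

text \<open>
  The multiple of \<open>p\<^sub>1\<close> left over by the identity is absorbed into the ideal.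
\<close>

lemma is_sos_upper_ray:
  fixes n :: nat
  defines "N \<equiv> real (n + 1)"
  assumes "n \<ge> 2"
  shows "is_sos n (Const (N ^ 2 - 3 * N + 3) * power_sum n 2 ^ 2 - Const (N * (N - 1)) * power_sum n 4)"
    (is "is_sos n ?f")
proof -
  let ?M = "of_nat (n + 1) :: mpoly"
  define h where "h = 4 * (?M - 1) ^ 2 * (?M - 2) * power_sum n 3
      - 2 * (?M - 1) * (?M - 2) * power_sum n 2 * power_sum n 1"
  have num: "numeral k \<in> carrier (poly_ring n)" "of_nat i \<in> carrier (poly_ring n)" for k i
    using Const_closed[of "numeral k" n] Const_closed[of "of_nat i" n] by simp_all
  have h: "- h \<in> carrier (poly_ring n)"
    unfolding h_def by (intro closed num)
  define v where "v i j = power_sum n 2 - (?M - 1) * (X i ^ 2 + X j ^ 2)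
      - (?M - 1) * (?M - 2) * (X i * X j)" for i j
  have "is_sos n (\<Sum>i\<in>{1..n+1}. \<Sum>j\<in>{1..n+1} - {i}. v i j ^ 2)"
    unfolding v_def by (intro is_sos_sum is_sos_square closed num) auto
  moreover have "(\<Sum>i\<in>{1..n+1}. \<Sum>j\<in>{1..n+1} - {i}. v i j ^ 2)
      = (?M - 1) * (?M - 2) * ((?M ^ 2 - 3 * ?M + 3) * power_sum n 2 ^ 2 - ?M * (?M - 1) * power_sum n 4)
        + power_sum n 1 * h"
    unfolding v_def h_def using sum_squares_two_index[of "{1..n+1}" X]
    by (simp only: card_atLeastAtMost diff_Suc_1 finite_atLeastAtMost power_sum_def simp_thms)
  moreover have "(?M - 1) * (?M - 2) * ((?M ^ 2 - 3 * ?M + 3) * power_sum n 2 ^ 2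
      - ?M * (?M - 1) * power_sum n 4) = Const ((N - 1) * (N - 2)) * ?f"
    by (simp only: N_def Const_hom Const_power single_of_nat single_numeral)
  ultimately have "is_sos n (Const ((N - 1) * (N - 2)) * ?f + power_sum n 1 * h)"
    by (simp only:)
  then have "is_sos n (Const ((N - 1) * (N - 2)) * ?f + power_sum n 1 * h + power_sum n 1 * (- h))"
    by (rule is_sos_add[OF _ is_sos_ideal[OF h]])
  then have "is_sos n (Const ((N - 1) * (N - 2)) * ?f)"
    by simp
  then have "is_sos n (Const (1 / ((N - 1) * (N - 2))) * (Const ((N - 1) * (N - 2)) * ?f))"
    by (rule is_sos_scale) (use assms(2) in \<open>simp add: N_def\<close>)
  moreover have "1 / ((N - 1) * (N - 2)) * ((N - 1) * (N - 2)) = 1"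
    using assms(2) by (simp add: N_def)
  ultimately show ?thesis
    unfolding mult.assoc[symmetric] Const_hom(4)[symmetric]
    by (simp only: Const_hom(2) mult_1_left mult.assoc)
qed

text \<open>
  The two inequalities are nonnegativity at ratio \<open>1 / N\<close> and at the vertex \<open>(N - 1, -1, \<dots>, -1)\<close>. Each
  of the two generators is zero at one of these places and positive at the other, so the
  coefficients of \<open>a p\<^sub>4 + b p\<^sub>2\<^sup>2\<close> in the generators are these two values, suitably scaled.
\<close>

lemma is_sos_if_nonneg_on_rays:
  fixes n :: nat
  defines "N \<equiv> real (n + 1)"
  assumes "n \<ge> 2" "0 \<le> a + b * N" "0 \<le> a * (N ^ 2 - 3 * N + 3) + b * (N * (N - 1))"
  shows "is_sos n (Const a * power_sum n 4 + Const b * power_sum n 2 ^ 2)"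
proof -
  \<comment> \<open>The determinant of the linear system for the two coefficients.\<close>
  define d where "d = N * (N - 2) ^ 2"
  have N: "N > 2"
    using assms(2) by (simp add: N_def)
  then have d: "d > 0"
    by (simp add: d_def)
  define u where "u = (a * (N ^ 2 - 3 * N + 3) + b * (N * (N - 1))) / d"
  define w where "w = (a + b * N) / d"
  have nonneg: "0 \<le> u" "0 \<le> w"
    using assms(3,4) d by (simp_all add: u_def w_def)
  have u: "u * d = a * (N ^ 2 - 3 * N + 3) + b * (N * (N - 1))" and w: "w * d = a + b * N"
    using d by (simp_all add: u_def w_def)
  have "d * a = u * d * N - w * d * (N * (N - 1))"
    unfolding u w unfolding d_def by (simp add: power_numeral_reduce algebra_simps)
  then have "d * a = d * (u * N - w * (N * (N - 1)))"
    by (simp only: algebra_simps)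
  then have a: "a = u * N - w * (N * (N - 1))"
    using d by (simp only: mult_cancel_left) simp
  have "d * b = w * d * (N ^ 2 - 3 * N + 3) - u * d"
    unfolding u w unfolding d_def by (simp add: power_numeral_reduce algebra_simps)
  then have "d * b = d * (w * (N ^ 2 - 3 * N + 3) - u)"
    by (simp only: algebra_simps)
  then have b: "b = w * (N ^ 2 - 3 * N + 3) - u"
    using d by (simp only: mult_cancel_left) simp
  have "Const a * power_sum n 4 + Const b * power_sum n 2 ^ 2
      = Const u * (Const N * power_sum n 4 - power_sum n 2 ^ 2)
        + Const w * (Const (N ^ 2 - 3 * N + 3) * power_sum n 2 ^ 2 - Const (N * (N - 1)) * power_sum n 4)"
    unfolding a b Const_hom by (simp only: algebra_simps)
  then show ?thesis
    using nonneg is_sos_lower_ray[of n] is_sos_upper_ray[OF assms(2)]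
    by (simp add: is_sos_add is_sos_scale N_def)
qed

section \<open>A quantitative lower bound for an odd number of variables\<close>

text \<open>
  Let \<open>m\<close> be the mean of the \<open>x\<^sub>i\<^sup>2\<close>, so that the variance \<open>p\<^sub>4 - p\<^sub>2\<^sup>2 / N\<close> is the sum of the
  \<open>(x\<^sub>i\<^sup>2 - m)\<^sup>2\<close>. Replacing each \<open>x\<^sub>i\<close> by \<open>\<plusminus>\<surd>m\<close> with the same sign gives an odd number of equal
  absolute values, whose total is at least \<open>\<surd>m\<close> in absolute value, while the \<open>x\<^sub>i\<close> sum to zero. So the
  \<open>x\<^sub>i\<close> are in total at least \<open>\<surd>m\<close> away from these points, hence the \<open>|x\<^sub>i\<^sup>2 - m|\<close> add up to at least \<open>m\<close>,
  and the variance is at least \<open>m\<^sup>2 / N = p\<^sub>2\<^sup>2 / N\<^sup>3\<close>.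
\<close>

lemma psd_separating_quartic:
  fixes x :: "'i \<Rightarrow> real"
  assumes "finite A" "odd (card A)" "(\<Sum>i\<in>A. x i) = 0"
  defines "N \<equiv> real (card A)"
  shows "(1 / N + 1 / N ^ 3) * (\<Sum>i\<in>A. x i ^ 2) ^ 2 \<le> (\<Sum>i\<in>A. x i ^ 4)"
proof -
  have N: "N > 0"
    using assms(2) by (auto simp: N_def intro: Nat.gr0I)
  define m where "m = (\<Sum>i\<in>A. x i ^ 2) / N"
  define t where "t = sqrt m"
  have m: "m \<ge> 0"
    using N by (simp add: m_def sum_nonneg)
  have t: "t \<ge> 0" "t * t = m"
    using m by (simp_all add: t_def)
  define s :: "'i \<Rightarrow> int" where "s i = (if x i \<ge> 0 then 1 else -1)" for i
  have "odd (\<Sum>i\<in>A. s i)"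
  proof -
    have "{i \<in> A. odd (s i)} = A"
      by (auto simp: s_def)
    then show ?thesis
      using assms(1,2) even_sum_iff[of A s] by simp
  qed
  then have "1 \<le> \<bar>\<Sum>i\<in>A. s i\<bar>"
    by (cases "(\<Sum>i\<in>A. s i) = 0") auto
  then have "1 \<le> \<bar>\<Sum>i\<in>A. real_of_int (s i)\<bar>"
    by (metis of_int_1_le_iff of_int_abs of_int_sum)
  then have "t \<le> t * \<bar>\<Sum>i\<in>A. real_of_int (s i)\<bar>"
    using t(1) mult_left_mono by fastforce
  also have "\<dots> = \<bar>\<Sum>i\<in>A. x i - t * s i\<bar>"
    using t(1) assms(3) by (simp add: sum_subtractf abs_mult flip: sum_distrib_left)
  also have "\<dots> \<le> (\<Sum>i\<in>A. \<bar>x i - t * s i\<bar>)"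
    by (rule sum_abs)
  finally have "t * t \<le> (\<Sum>i\<in>A. t * \<bar>x i - t * s i\<bar>)"
    using t(1) mult_left_mono by (fastforce simp flip: sum_distrib_left)
  also have "\<dots> \<le> (\<Sum>i\<in>A. \<bar>x i ^ 2 - m\<bar>)"
  proof (rule sum_mono)
    fix i assume "i \<in> A"
    have "x i ^ 2 - m = (x i - t * s i) * (x i + t * s i)"
      using t(2) by (simp add: s_def power2_eq_square algebra_simps)
    then have "\<bar>x i ^ 2 - m\<bar> = \<bar>x i - t * s i\<bar> * \<bar>x i + t * s i\<bar>"
      by (simp add: abs_mult)
    moreover have "t \<le> \<bar>x i + t * s i\<bar>"
      using t(1) by (simp add: s_def)
    ultimately show "t * \<bar>x i - t * s i\<bar> \<le> \<bar>x i ^ 2 - m\<bar>"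
      using mult_right_mono[of t "\<bar>x i + t * s i\<bar>" "\<bar>x i - t * s i\<bar>"]
      by (simp add: mult.commute)
  qed
  finally have abs_bound: "m \<le> (\<Sum>i\<in>A. \<bar>x i ^ 2 - m\<bar>)"
    by (simp add: t)
  \<comment> \<open>The Cauchy-Schwarz step, through the tangent line of the square at \<open>m / N\<close>.\<close>
  have "m ^ 2 / N = 2 * (m / N) * m - N * (m / N) ^ 2"
    using N by (simp add: power2_eq_square field_simps)
  also have "\<dots> \<le> 2 * (m / N) * (\<Sum>i\<in>A. \<bar>x i ^ 2 - m\<bar>) - N * (m / N) ^ 2"
    using abs_bound m N by (simp add: mult_left_mono divide_right_mono)
  also have "\<dots> = (\<Sum>i\<in>A. 2 * (m / N) * \<bar>x i ^ 2 - m\<bar> - (m / N) ^ 2)"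
    unfolding sum_subtractf sum_distrib_left[symmetric] by (simp add: N_def)
  also have "\<dots> \<le> (\<Sum>i\<in>A. (x i ^ 2 - m) ^ 2)"
  proof (rule sum_mono)
    fix i assume "i \<in> A"
    have "0 \<le> (\<bar>y\<bar> - z) ^ 2" for y z :: real
      by simp
    then have "2 * z * \<bar>y\<bar> - z ^ 2 \<le> y ^ 2" for y z :: real
      by (simp only: power2_diff power2_abs) (simp add: algebra_simps)
    then show "2 * (m / N) * \<bar>x i ^ 2 - m\<bar> - (m / N) ^ 2 \<le> (x i ^ 2 - m) ^ 2" .
  qed
  also have "\<dots> = (\<Sum>i\<in>A. x i ^ 4 - 2 * m * x i ^ 2 + m ^ 2)"
    by (rule sum.cong) (simp_all add: power_numeral_reduce algebra_simps)
  also have "\<dots> = (\<Sum>i\<in>A. x i ^ 4) - 2 * m * (\<Sum>i\<in>A. x i ^ 2) + N * m ^ 2"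
    by (simp add: sum.distrib sum_subtractf N_def flip: sum_distrib_left)
  also have "(\<Sum>i\<in>A. x i ^ 2) = N * m"
    using N by (simp add: m_def)
  finally have "m ^ 2 / N + N * m ^ 2 \<le> (\<Sum>i\<in>A. x i ^ 4)"
    by (simp add: power2_eq_square)
  moreover have "(1 / N + 1 / N ^ 3) * (\<Sum>i\<in>A. x i ^ 2) ^ 2 = m ^ 2 / N + N * m ^ 2"
    using N by (simp add: m_def power_numeral_reduce field_simps)
  ultimately show ?thesis
    by simp
qed

section \<open>A functional nonnegative on squares of quadratic forms\<close>

text \<open>
  For \<open>D i j\<close> the value of a quadratic form at \<open>e\<^sub>i - e\<^sub>j\<close>, the number \<open>q i\<close> is its value at
  \<open>N e\<^sub>i - (1, \<dots>, 1)\<close> (see \<open>quadratic_part_difference_formula\<close>). The inequality is Bessel's: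
  the off-diagonal part of \<open>D\<close> has nonnegative distance to the matrix with entries \<open>t (q i + q j)\<close>,
  where \<open>t = 1 / (N (N - 2))\<close>. This \<open>t\<close> is optimal if the \<open>q i\<close> sum to zero; otherwise
  a multiple of the square of the sum of all entries remains, with coefficient \<open>N (N - 4) / 2\<close>, and this
  term has the right sign because \<open>N \<ge> 4\<close>.
\<close>

lemma zero_diagonal_matrix_bound:
  fixes D :: "'i \<Rightarrow> 'i \<Rightarrow> real"
  assumes "finite A" "card A \<ge> 4"
    and sym: "\<And>i j. D i j = D j i" and diag: "\<And>i. D i i = 0"
  defines "N \<equiv> real (card A)"
  defines "q \<equiv> \<lambda>i. N * (\<Sum>j\<in>A. D i j) - (\<Sum>k\<in>A. \<Sum>j\<in>A. D k j) / 2"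
  shows "2 * (\<Sum>i\<in>A. q i ^ 2) \<le> N ^ 2 * (N - 2) * (\<Sum>i\<in>A. \<Sum>j\<in>A. D i j ^ 2)"
proof -
  define r where "r i = (\<Sum>j\<in>A. D i j)" for i
  define S F W where "S = (\<Sum>i\<in>A. r i)" and "F = (\<Sum>i\<in>A. \<Sum>j\<in>A. D i j ^ 2)" and "W = (\<Sum>i\<in>A. q i ^ 2)"
  \<comment> \<open>The reciprocal of the coefficient \<open>t\<close>; scaling by it avoids fractions.\<close>
  define K where "K = N * (N - 2)"
  have N: "N \<ge> 4"
    using assms(2) by (simp add: N_def)
  have q: "q i = N * r i - S / 2" for i
    by (simp add: q_def r_def S_def)
  have sum_q: "(\<Sum>i\<in>A. q i) = N * S / 2"
    by (simp add: q sum_subtractf S_def N_def flip: sum_distrib_left)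
  have "W = (\<Sum>i\<in>A. q i * (N * r i - S / 2))"
    by (simp add: W_def power2_eq_square flip: q)
  also have "\<dots> = (\<Sum>i\<in>A. N * (r i * q i) - S / 2 * q i)"
    by (rule sum.cong) (simp_all add: algebra_simps)
  also have "\<dots> = N * (\<Sum>i\<in>A. r i * q i) - S / 2 * (N * S / 2)"
    unfolding sum_subtractf sum_distrib_left[symmetric] sum_q ..
  finally have rq: "N * (\<Sum>i\<in>A. r i * q i) = W + N * S ^ 2 / 4"
    by (simp add: power2_eq_square)
  have Dq: "(\<Sum>i\<in>A. \<Sum>j\<in>A. D i j * q i) = (\<Sum>i\<in>A. r i * q i)"
    by (simp add: r_def sum_distrib_right)
  have Dq': "(\<Sum>i\<in>A. \<Sum>j\<in>A. D i j * q j) = (\<Sum>i\<in>A. r i * q i)"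
    by (subst sum.swap, subst sym) (rule Dq)
  have qq: "(\<Sum>i\<in>A. \<Sum>j\<in>A. q i ^ 2) = N * W" "(\<Sum>i\<in>A. \<Sum>j\<in>A. q j ^ 2) = N * W"
    by (simp_all add: W_def N_def flip: sum_distrib_left)
  have qiqj: "(\<Sum>i\<in>A. \<Sum>j\<in>A. q i * q j) = (N * S / 2) ^ 2"
    by (simp only: power2_eq_square sum_q[symmetric] sum_product)
  have lin: "(\<Sum>i\<in>A. \<Sum>j\<in>A. c * f i j) = c * (\<Sum>i\<in>A. \<Sum>j\<in>A. f i j)" for c :: real and f
    by (simp add: sum_distrib_left)
  have "0 \<le> (\<Sum>i\<in>A. (\<Sum>j\<in>A. (K * D i j - (q i + q j)) ^ 2) - (K * D i i - (q i + q i)) ^ 2)"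
  proof (rule sum_nonneg)
    fix i assume "i \<in> A"
    then show "0 \<le> (\<Sum>j\<in>A. (K * D i j - (q i + q j)) ^ 2) - (K * D i i - (q i + q i)) ^ 2"
      using assms(1) member_le_sum[of i A "\<lambda>j. (K * D i j - (q i + q j)) ^ 2"] by simp
  qed
  also have "\<dots> = (\<Sum>i\<in>A. \<Sum>j\<in>A. (K * D i j - (q i + q j)) ^ 2) - 4 * W"
    unfolding sum_subtractf diag W_def by (simp add: power2_eq_square sum_distrib_left)
  also have "(\<Sum>i\<in>A. \<Sum>j\<in>A. (K * D i j - (q i + q j)) ^ 2)
      = (\<Sum>i\<in>A. \<Sum>j\<in>A. K ^ 2 * D i j ^ 2 + (- 2 * K) * (D i j * q i) + (- 2 * K) * (D i j * q j)
          + q i ^ 2 + q j ^ 2 + 2 * (q i * q j))"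
    by (intro sum.cong refl) (simp add: power2_eq_square algebra_simps)
  also have "\<dots> = K ^ 2 * F - 4 * K * (\<Sum>i\<in>A. r i * q i) + 2 * N * W + 2 * (N * S / 2) ^ 2"
    by (simp only: sum.distrib lin Dq Dq' qq qiqj F_def)
  also have "4 * K * (\<Sum>i\<in>A. r i * q i) = 4 * (N - 2) * (W + N * S ^ 2 / 4)"
    unfolding rq[symmetric] K_def by simp
  finally have "0 \<le> K ^ 2 * F - 4 * (N - 2) * (W + N * S ^ 2 / 4) + 2 * N * W + 2 * (N * S / 2) ^ 2 - 4 * W" .
  also have "\<dots> = (N - 2) * (N ^ 2 * (N - 2) * F - 2 * W) - N * (N - 4) / 2 * S ^ 2"
    unfolding K_def by (simp add: power_numeral_reduce field_simps)
  also have "\<dots> \<le> (N - 2) * (N ^ 2 * (N - 2) * F - 2 * W)"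
    using N by simp
  finally show ?thesis
    using N by (simp add: zero_le_mult_iff F_def W_def)
qed

text \<open>
  Both sides are linear in the quadratic form, so this polarization
  identity for the single monomial \<open>x\<^sub>k x\<^sub>l\<close> extends linearly to \<open>quadratic_part_difference_formula\<close>.
\<close>

lemma square_differences_value:
  fixes e :: "'i \<Rightarrow> 'i \<Rightarrow> real"
  assumes "finite A" "k \<in> A" "l \<in> A"
    and e_def: "\<And>i k. e i k = (if k = i then 1 else 0)"
  defines "N \<equiv> real (card A)"
  shows "(N * e i k - 1) * (N * e i l - 1)
    = N * (\<Sum>j\<in>A. (e i k - e j k) * (e i l - e j l))
      - (\<Sum>h\<in>A. \<Sum>j\<in>A. (e h k - e j k) * (e h l - e j l)) / 2"
proof -
  have s1: "(\<Sum>j\<in>A. e j p) = 1" if "p \<in> A" for p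
    using assms(1) that by (simp add: e_def sum.delta)
  have s2: "(\<Sum>j\<in>A. e j k * e j l) = e k l"
  proof -
    have "e j k * e j l = (if k = j then e k l else 0)" for j
      by (simp add: e_def)
    then show ?thesis
      using assms(1,2) by (simp add: sum.delta)
  qed
  have row: "(\<Sum>j\<in>A. (e h k - e j k) * (e h l - e j l)) = N * (e h k * e h l) - e h k - e h l + e k l" for h
  proof -
    have "(\<Sum>j\<in>A. (e h k - e j k) * (e h l - e j l))
        = (\<Sum>j\<in>A. e h k * e h l - e h k * e j l - e h l * e j k + e j k * e j l)"
      by (rule sum.cong) (simp_all add: algebra_simps)
    also have "\<dots> = N * (e h k * e h l) - e h k - e h l + e k l"
      using assms(2,3) by (simp add: sum.distrib sum_subtractf s1 s2 N_def flip: sum_distrib_left)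
    finally show ?thesis .
  qed
  have total: "(\<Sum>h\<in>A. \<Sum>j\<in>A. (e h k - e j k) * (e h l - e j l)) = 2 * N * e k l - 2"
    unfolding row using assms(2,3)
    by (simp add: sum.distrib sum_subtractf s1 s2 N_def flip: sum_distrib_left)
  show ?thesis
    unfolding total unfolding row by (simp add: algebra_simps diff_divide_distrib)
qed

text \<open>
  The value at \<open>x\<close> of the homogeneous component of degree two.
\<close>

definition quadratic_part :: "mpoly \<Rightarrow> (nat \<Rightarrow> real) \<Rightarrow> real" where
  "quadratic_part g x = (\<Sum>m\<in>Poly_Mapping.keys g.
     if monom_degree m = 2 then Poly_Mapping.lookup g m * monom_value x m else 0)"

text \<open>
  A quadratic form on the hyperplane is determined by its values at the vectors \<open>e\<^sub>i - e\<^sub>j\<close>; this is the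
  resulting value at \<open>N e\<^sub>i - (1, \<dots>, 1)\<close>, which is the sum of all \<open>e\<^sub>i - e\<^sub>j\<close> with \<open>i\<close> fixed.
\<close>

lemma quadratic_part_difference_formula:
  fixes n :: nat
  assumes "g \<in> carrier (poly_ring n)" "i \<in> {1..n+1}"
  defines "N \<equiv> real (n + 1)"
  defines "e \<equiv> \<lambda>i k :: nat. if k = i then 1 else 0 :: real"
  shows "quadratic_part g (\<lambda>k. N * e i k - 1)
    = N * (\<Sum>j=1..n+1. quadratic_part g (\<lambda>k. e i k - e j k))
      - (\<Sum>h=1..n+1. \<Sum>j=1..n+1. quadratic_part g (\<lambda>k. e h k - e j k)) / 2"
proof -
  define A where "A = {1..n+1}"
  have A: "finite A" "i \<in> A" "N = real (card A)"
    using assms(2) by (simp_all add: A_def N_def)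
  define w where "w x m = (if monom_degree m = 2 then Poly_Mapping.lookup g m * monom_value x m else 0)"
    for x m
  have mono: "w (\<lambda>k. N * e i k - 1) m
      = N * (\<Sum>j\<in>A. w (\<lambda>k. e i k - e j k) m) - (\<Sum>h\<in>A. \<Sum>j\<in>A. w (\<lambda>k. e h k - e j k) m) / 2"
    if m: "m \<in> Poly_Mapping.keys g" for m
  proof (cases "monom_degree m = 2")
    case True
    obtain k m1 where 1: "m = Poly_Mapping.single k 1 + m1" "k \<in> Poly_Mapping.keys m"
      "monom_degree m1 = 1" "Poly_Mapping.keys m1 \<subseteq> Poly_Mapping.keys m"
      using monom_degree_Suc[of m 1] True by auto
    obtain l m2 where 2: "m1 = Poly_Mapping.single l 1 + m2" "l \<in> Poly_Mapping.keys m1"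
      "monom_degree m2 = 0" "Poly_Mapping.keys m2 \<subseteq> Poly_Mapping.keys m1"
      using monom_degree_Suc[of m1 0] 1 by auto
    have m2: "m2 = 0"
      using 2(3) by (rule monom_degree_0)
    have val: "monom_value x m = x k * x l" for x
      unfolding 1(1) 2(1) m2 by (subst monom_value_add) simp
    have "Poly_Mapping.keys m \<subseteq> A"
      using assms(1) m unfolding carrier_poly_ring A_def by blast
    then have kl: "k \<in> A" "l \<in> A"
      using 1 2 by auto
    define c where "c = Poly_Mapping.lookup g m"
    have w: "w x m = c * (x k * x l)" for x
      unfolding w_def c_def using True by (simp add: val)
    have "e i k = (if k = i then 1 else 0)" for i k
      by (simp add: e_def)
    note difference = square_differences_value[OF A(1) kl this, folded A(3)]
    have aux: "c * (N * y - z / 2) = N * (c * y) - (c * z) / 2" for y z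
      by (simp add: field_simps)
    show ?thesis
      unfolding w sum_distrib_left[symmetric] difference by (rule aux)
  next
    case False
    then show ?thesis
      by (simp add: w_def)
  qed
  have swap: "(\<Sum>m\<in>Poly_Mapping.keys g. \<Sum>j\<in>A. f j m) = (\<Sum>j\<in>A. \<Sum>m\<in>Poly_Mapping.keys g. f j m)"
    for f :: "nat \<Rightarrow> _ \<Rightarrow> real"
    by (rule sum.swap)
  have "(\<Sum>m\<in>Poly_Mapping.keys g. w (\<lambda>k. N * e i k - 1) m)
    = N * (\<Sum>j\<in>A. \<Sum>m\<in>Poly_Mapping.keys g. w (\<lambda>k. e i k - e j k) m)
      - (\<Sum>h\<in>A. \<Sum>j\<in>A. \<Sum>m\<in>Poly_Mapping.keys g. w (\<lambda>k. e h k - e j k) m) / 2"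
    by (simp add: mono sum_subtractf swap flip: sum_distrib_left sum_divide_distrib)
  then show ?thesis
    unfolding quadratic_part_def w_def A_def .
qed

text \<open>
  Squares of real numbers do not cancel, so the constant and then the linear coefficients all vanish.
\<close>

lemma sum_of_squares_eq_monom_4:
  fixes p :: "'j \<Rightarrow> real poly"
  assumes "finite J" "(\<Sum>j\<in>J. p j ^ 2) = monom c 4"
  shows "c = (\<Sum>j\<in>J. coeff (p j) 2 ^ 2)"
proof -
  have coeff: "(\<Sum>j\<in>J. \<Sum>i\<le>k. coeff (p j) i * coeff (p j) (k - i)) = (if k = 4 then c else 0)" for k
    using arg_cong[OF assms(2), of "\<lambda>q. coeff q k"]
    by (simp add: coeff_sum power2_eq_square coeff_mult eq_commute)
  have "(\<Sum>j\<in>J. coeff (p j) 0 ^ 2) = 0"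
    using coeff[of 0] by (simp add: power2_eq_square)
  then have c0: "coeff (p j) 0 = 0" if "j \<in> J" for j
    using assms(1) that by (simp add: sum_nonneg_eq_0_iff)
  have "(\<Sum>i\<le>2. coeff (p j) i * coeff (p j) (2 - i)) = coeff (p j) 1 ^ 2" if "j \<in> J" for j
    using c0[OF that] by (simp add: numeral_2_eq_2 power2_eq_square)
  then have "(\<Sum>j\<in>J. coeff (p j) 1 ^ 2) = 0"
    using coeff[of 2] by simp
  then have c1: "coeff (p j) 1 = 0" if "j \<in> J" for j
    using assms(1) that by (simp add: sum_nonneg_eq_0_iff)
  have "(\<Sum>i\<le>4. coeff (p j) i * coeff (p j) (4 - i)) = coeff (p j) 2 ^ 2" if "j \<in> J" for j
    using c0[OF that] c1[OF that] by (simp add: eval_nat_numeral)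
  then show ?thesis
    using coeff[of 4] by simp
qed

text \<open>
  Along a line through the origin the previous lemma applies, so in a sum of squares that is a
  quartic form on that line only the quadratic components of the summands contribute.
\<close>

lemma quartic_sos_quadratic_parts:
  assumes "finite J"
    and sos: "\<And>t. (\<Sum>j\<in>J. eval_poly (\<lambda>i. t * x i) (g j) ^ 2) = c * t ^ 4"
  shows "c = (\<Sum>j\<in>J. quadratic_part (g j) x ^ 2)"
proof -
  \<comment> \<open>The restriction of \<open>f\<close> to the line through \<open>x\<close>, as a univariate polynomial.\<close>
  define p where "p f = (\<Sum>m\<in>Poly_Mapping.keys f.
    monom (Poly_Mapping.lookup f m * monom_value x m) (monom_degree m))" for f
  have "monom_value (\<lambda>i. t * x i) m = monom_value x m * t ^ monom_degree m" for t m
    by (simp only: power_mult_distrib prod.distrib power_sum mult.commute)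
  then have "poly (p f) t = eval_poly (\<lambda>i. t * x i) f" for f t
    unfolding p_def eval_poly_def by (simp add: poly_sum poly_monom mult.assoc)
  then have "poly (\<Sum>j\<in>J. p (g j) ^ 2) t = poly (monom c 4) t" for t
    by (simp add: poly_sum sos poly_monom)
  then have "poly (\<Sum>j\<in>J. p (g j) ^ 2) = poly (monom c 4)"
    by (rule ext)
  then have "(\<Sum>j\<in>J. p (g j) ^ 2) = monom c 4"
    by (simp only: poly_eq_poly_eq_iff)
  moreover have "coeff (p f) 2 = quadratic_part f x" for f
    unfolding p_def quadratic_part_def by (simp add: coeff_sum)
  ultimately show ?thesis
    using sum_of_squares_eq_monom_4[OF assms(1), of "\<lambda>j. p (g j)" c] by simp
qed

lemma is_sos_nonneg:
  assumes "is_sos n f" "(\<Sum>i=1..n+1. a i) = 0"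
  shows "0 \<le> eval_poly a f"
proof -
  obtain l g h where "f = (\<Sum>j = 1..l::nat. g j ^ 2) + power_sum n 1 * h"
    using assms(1) by (rule is_sosE)
  then have "eval_poly a f = (\<Sum>j = 1..l. eval_poly a (g j) ^ 2)"
    using assms(2) by (simp add: eval_power_sum)
  then show ?thesis
    by (simp add: sum_nonneg)
qed

text \<open>
  On the hyperplane the quartic is a sum of squares of quadratic forms, and each of these obeys
  \<open>zero_diagonal_matrix_bound\<close>. Adding up gives an inequality between the values of the quartic at
  \<open>e\<^sub>i - e\<^sub>j\<close> and at \<open>N e\<^sub>i - (1, \<dots>, 1)\<close>, which amounts to \<open>a + b N \<ge> 0\<close> up to a factor that is
  positive because \<open>N > 3\<close>.
\<close>

lemma is_sos_necessary:
  fixes n :: nat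
  defines "N \<equiv> real (n + 1)"
  assumes "n > 3" "is_sos n (Const a * power_sum n 4 + Const b * power_sum n 2 ^ 2)"
  shows "0 \<le> a + b * N"
proof -
  define A where "A = {1..n+1}"
  have A: "finite A" "card A = n + 1" "N = real (card A)"
    by (simp_all add: A_def N_def)
  define e where "e i k = (if k = i then 1 else 0 :: real)" for i k :: nat
  define F where "F x = a * (\<Sum>i\<in>A. x i ^ 4) + b * (\<Sum>i\<in>A. x i ^ 2) ^ 2" for x :: "nat \<Rightarrow> real"
  obtain l g h where g: "\<forall>j \<in> {1..l::nat}. g j \<in> carrier (poly_ring n)"
    "Const a * power_sum n 4 + Const b * power_sum n 2 ^ 2 = (\<Sum>j = 1..l. g j ^ 2) + power_sum n 1 * h"
    using assms(3) by (rule is_sosE)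
  have F: "F x = (\<Sum>j = 1..l. quadratic_part (g j) x ^ 2)" if x: "(\<Sum>i\<in>A. x i) = 0" for x
  proof (rule quartic_sos_quadratic_parts)
    fix t
    have "(\<Sum>j = 1..l. eval_poly (\<lambda>i. t * x i) (g j) ^ 2) = F (\<lambda>i. t * x i)"
      using arg_cong[OF g(2), of "eval_poly (\<lambda>i. t * x i)"] x
      by (simp add: eval_power_sum F_def A_def flip: sum_distrib_left)
    also have "\<dots> = F x * t ^ 4"
      by (simp add: F_def power_mult_distrib algebra_simps flip: sum_distrib_left power_mult)
    finally show "(\<Sum>j = 1..l. eval_poly (\<lambda>i. t * x i) (g j) ^ 2) = F x * t ^ 4" .
  qed simp
  have e1: "(\<Sum>k\<in>A. e i k) = 1" if "i \<in> A" for i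
    using A(1) that by (simp add: e_def sum.delta')
  have roots: "F (\<lambda>k. e i k - e j k) = (if i = j then 0 else 2 * a + 4 * b)" if "i \<in> A" "j \<in> A" for i j
  proof -
    have "(e i k - e j k) ^ r = (if i = j then 0 else e i k + e j k)" if "r = 2 \<or> r = 4" for k r
      using that by (auto simp: e_def)
    then have "(\<Sum>k\<in>A. (e i k - e j k) ^ r) = (if i = j then 0 else 2)" if "r = 2 \<or> r = 4" for r
      using that \<open>i \<in> A\<close> \<open>j \<in> A\<close> by (simp add: sum.distrib e1)
    then show ?thesis
      by (simp add: F_def)
  qed
  have vertices: "F (\<lambda>k. N * e i k - 1) = a * ((N - 1) ^ 4 + (N - 1)) + b * (N * (N - 1)) ^ 2" if "i \<in> A" for i
  proof -
    have "(N * e i k - 1) ^ r = ((N - 1) ^ r - 1) * e i k + 1" if "r = 2 \<or> r = 4" for k r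
      using that by (auto simp: e_def)
    then have "(\<Sum>k\<in>A. (N * e i k - 1) ^ r) = (N - 1) ^ r - 1 + N" if "r = 2 \<or> r = 4" for r
      using that e1[OF \<open>i \<in> A\<close>] A(3) by (simp add: sum.distrib flip: sum_distrib_left)
    then have "F (\<lambda>k. N * e i k - 1) = a * ((N - 1) ^ 4 - 1 + N) + b * ((N - 1) ^ 2 - 1 + N) ^ 2"
      by (simp only: F_def simp_thms)
    also have "(N - 1) ^ 2 - 1 + N = N * (N - 1)"
      by (simp add: power2_eq_square algebra_simps)
    finally show ?thesis
      by simp
  qed
  have bound: "2 * (\<Sum>i\<in>A. quadratic_part f (\<lambda>k. N * e i k - 1) ^ 2)
      \<le> N ^ 2 * (N - 2) * (\<Sum>i\<in>A. \<Sum>j\<in>A. quadratic_part f (\<lambda>k. e i k - e j k) ^ 2)"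
    if f: "f \<in> carrier (poly_ring n)" for f
  proof -
    define D where "D i j = quadratic_part f (\<lambda>k. e i k - e j k)" for i j
    \<comment> \<open>A quadratic form is even and vanishes at the origin.\<close>
    have D: "D i j = D j i" "D i i = 0" for i j
    proof -
      have flip: "monom_value (\<lambda>k. e i k - e j k) m = monom_value (\<lambda>k. e j k - e i k) m"
        if "monom_degree m = 2" for m
      proof -
        have "monom_value (\<lambda>k. e i k - e j k) m
            = (\<Prod>k\<in>Poly_Mapping.keys m. (- 1) ^ Poly_Mapping.lookup m k * (e j k - e i k) ^ Poly_Mapping.lookup m k)"
          by (simp flip: power_mult_distrib)
        also have "\<dots> = (- 1) ^ monom_degree m * monom_value (\<lambda>k. e j k - e i k) m"
          by (simp only: prod.distrib power_sum)
        finally show ?thesis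
          using that by simp
      qed
      show "D i j = D j i"
        unfolding D_def quadratic_part_def by (rule sum.cong) (auto simp: flip)
      have zero: "monom_value (\<lambda>k. 0) m = 0" if "monom_degree m = 2" for m
      proof -
        have "Poly_Mapping.keys m \<noteq> {}"
          using that by auto
        then obtain k where "k \<in> Poly_Mapping.keys m"
          by blast
        then show ?thesis
          by (intro prod_zero) (auto simp: in_keys_iff)
      qed
      then show "D i i = 0"
        unfolding D_def quadratic_part_def diff_self
        by (intro sum.neutral ballI) (simp only: zero mult_zero_right if_cancel cong: if_cong)
    qed
    have "quadratic_part f (\<lambda>k. N * e i k - 1)
        = N * (\<Sum>j\<in>A. D i j) - (\<Sum>k\<in>A. \<Sum>j\<in>A. D k j) / 2" if "i \<in> A" for i
      unfolding D_def e_def A_def N_def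
      by (rule quadratic_part_difference_formula[OF f]) (use that in \<open>simp add: A_def\<close>)
    then show ?thesis
      using zero_diagonal_matrix_bound[OF A(1) _ D] A assms(2) by (simp add: D_def)
  qed
  have "(\<Sum>j = 1..l. 2 * (\<Sum>i\<in>A. quadratic_part (g j) (\<lambda>k. N * e i k - 1) ^ 2))
      \<le> (\<Sum>j = 1..l. N ^ 2 * (N - 2) * (\<Sum>i\<in>A. \<Sum>k\<in>A. quadratic_part (g j) (\<lambda>p. e i p - e k p) ^ 2))"
    by (rule sum_mono) (use bound g(1) in blast)
  also have "\<dots> = N ^ 2 * (N - 2) * (\<Sum>i\<in>A. \<Sum>k\<in>A. \<Sum>j = 1..l. quadratic_part (g j) (\<lambda>p. e i p - e k p) ^ 2)"
    unfolding sum_distrib_left[symmetric]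
    by (subst sum.swap, subst (2) sum.swap) (rule refl)
  also have "(\<Sum>i\<in>A. \<Sum>k\<in>A. \<Sum>j = 1..l. quadratic_part (g j) (\<lambda>p. e i p - e k p) ^ 2)
      = (\<Sum>i\<in>A. \<Sum>k\<in>A. F (\<lambda>p. e i p - e k p))"
    by (intro sum.cong refl F[symmetric]) (simp add: sum_subtractf e1)
  also have "\<dots> = (\<Sum>i\<in>A. \<Sum>k\<in>A. if i = k then 0 else 2 * a + 4 * b)"
    by (intro sum.cong refl roots)
  also have "\<dots> = (\<Sum>i\<in>A. (N - 1) * (2 * a + 4 * b))"
  proof (rule sum.cong)
    fix i assume i: "i \<in> A"
    have "(\<Sum>k\<in>A. if i = k then 0 else c) = (\<Sum>k\<in>A. c - (if i = k then c else 0))" for c :: real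
      by (rule sum.cong) auto
    also have "(\<Sum>k\<in>A. c - (if i = k then c else 0)) = (N - 1) * c" for c :: real
      using A(1,3) i by (simp add: sum_subtractf algebra_simps)
    finally show "(\<Sum>k\<in>A. if i = k then 0 else 2 * a + 4 * b) = (N - 1) * (2 * a + 4 * b)" .
  qed simp
  also have "\<dots> = N * ((N - 1) * (2 * a + 4 * b))"
    by (simp add: A(3))
  also have "(\<Sum>j = 1..l. 2 * (\<Sum>i\<in>A. quadratic_part (g j) (\<lambda>k. N * e i k - 1) ^ 2))
      = 2 * (\<Sum>i\<in>A. \<Sum>j = 1..l. quadratic_part (g j) (\<lambda>k. N * e i k - 1) ^ 2)"
    unfolding sum_distrib_left[symmetric] by (subst sum.swap) (rule refl)
  also have "(\<Sum>i\<in>A. \<Sum>j = 1..l. quadratic_part (g j) (\<lambda>k. N * e i k - 1) ^ 2)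
      = (\<Sum>i\<in>A. F (\<lambda>k. N * e i k - 1))"
    by (intro sum.cong refl F[symmetric]) (simp add: sum_subtractf e1 A(3) flip: sum_distrib_left)
  also have "\<dots> = (\<Sum>i\<in>A. a * ((N - 1) ^ 4 + (N - 1)) + b * (N * (N - 1)) ^ 2)"
    by (intro sum.cong refl vertices)
  also have "\<dots> = N * (a * ((N - 1) ^ 4 + (N - 1)) + b * (N * (N - 1)) ^ 2)"
    by (simp add: A(3))
  finally have "0 \<le> N ^ 2 * (N - 2) * (N * ((N - 1) * (2 * a + 4 * b)))
      - 2 * (N * (a * ((N - 1) ^ 4 + (N - 1)) + b * (N * (N - 1)) ^ 2))"
    by simp
  also have "\<dots> = 2 * N ^ 2 * (N - 1) * (N - 3) * (a + b * N)"
    by (simp add: power_numeral_reduce algebra_simps)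
  finally have "0 \<le> 2 * N ^ 2 * (N - 1) * (N - 3) * (a + b * N)" .
  moreover have "0 < 2 * N ^ 2 * (N - 1) * (N - 3)"
    using assms(2) by (simp add: N_def)
  ultimately show ?thesis
    by (metis zero_le_mult_iff not_less)
qed

section \<open>Membership in the two cones\<close>

lemma homogeneous_single: "homogeneous (monom_degree m) (Poly_Mapping.single m c)"
  by (simp add: homogeneous_def)

lemma homogeneous_X: "homogeneous 1 (X i)"
  using homogeneous_single[of "Poly_Mapping.single i 1" 1] by (simp add: X_def)

lemma homogeneous_Const: "homogeneous 0 (Const c)"
  using homogeneous_single[of 0 c] by simp

lemma homogeneous_add:
  assumes "homogeneous d f" "homogeneous d g"
  shows "homogeneous d (f + g)"
  using assms keys_add[of f g] unfolding homogeneous_def by blast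

lemma homogeneous_sum: "(\<And>i. i \<in> S \<Longrightarrow> homogeneous d (f i)) \<Longrightarrow> homogeneous d (sum f S)"
  by (induction S rule: infinite_finite_induct) (simp_all add: homogeneous_add, simp_all add: homogeneous_def)

lemma homogeneous_mult:
  assumes "homogeneous d f" "homogeneous e g"
  shows "homogeneous (d + e) (f * g)"
  unfolding homogeneous_def
proof
  fix m assume "m \<in> Poly_Mapping.keys (f * g)"
  then obtain k l where "m = k + l" "k \<in> Poly_Mapping.keys f" "l \<in> Poly_Mapping.keys g"
    using keys_mult[of f g] by blast
  then show "monom_degree m = d + e"
    using assms monom_degree_add[of k l] unfolding homogeneous_def by simp
qed

lemma homogeneous_power: "homogeneous d f \<Longrightarrow> homogeneous (d * k) (f ^ k)"
proof (induction k)
  case 0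
  then show ?case
    using homogeneous_Const[of 1] by simp
next
  case (Suc k)
  then show ?case
    using homogeneous_mult[of d f "d * k" "f ^ k"] by simp
qed

lemma homogeneous_power_sum: "homogeneous k (power_sum n k)"
  unfolding power_sum_def
  by (rule homogeneous_sum) (use homogeneous_power[OF homogeneous_X] in auto)

lemma permute_image_coset:
  assumes \<sigma>: "\<sigma> permutes {1..n+1}" and f: "\<And>\<tau>. \<tau> permutes {1..n+1} \<Longrightarrow> permute \<tau> f = f"
  shows "permute \<sigma> ` coset n f = coset n f"
proof -
  have sub: "permute \<tau> g \<in> coset n f" if \<tau>: "\<tau> permutes {1..n+1}" and "g \<in> coset n f" for \<tau> g
  proof -
    obtain h where "g = f + power_sum n 1 * h" "h \<in> carrier (poly_ring n)"
      using \<open>g \<in> coset n f\<close> by (auto simp: coset_def)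
    then have "permute \<tau> g = f + power_sum n 1 * permute \<tau> h" "permute \<tau> h \<in> carrier (poly_ring n)"
      using permute_closed[OF \<tau>]
      by (simp_all only: permute_add[OF \<tau>] permute_mult[OF \<tau>] permute_power_sum[OF \<tau>] f[OF \<tau>])
    then show ?thesis
      unfolding coset_def by blast
  qed
  let ?\<tau> = "inv_into UNIV \<sigma>"
  have \<tau>: "?\<tau> permutes {1..n+1}"
    using \<sigma> by (rule permutes_inv)
  have "g \<in> permute \<sigma> ` coset n f" if "g \<in> coset n f" for g
  proof (rule image_eqI)
    have "Poly_Mapping.map_key id = (id :: (nat \<Rightarrow>\<^sub>0 nat) \<Rightarrow> _)"
      by (rule ext) (simp add: id_def map_key_id)
    then have "permute id g = g"
      by (simp add: permute_def) (simp add: id_def map_key_id)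
    then show "g = permute \<sigma> (permute ?\<tau> g)"
      by (simp only: permute_permute[OF \<sigma> \<tau>] permutes_inv_o(1)[OF \<sigma>])
    show "permute ?\<tau> g \<in> coset n f"
      using sub[OF \<tau> that] .
  qed
  then show ?thesis
    using sub[OF \<sigma>] by blast
qed

lemma coset_invariant_quartic:
  "coset n (Const a * power_sum n 4 + Const b * power_sum n 2 ^ 2) \<in> invariant_quartics n"
proof -
  define f where "f = Const a * power_sum n 4 + Const b * power_sum n 2 ^ 2"
  have "homogeneous (0 + 4) (Const a * power_sum n 4)" "homogeneous (0 + 2 * 2) (Const b * power_sum n 2 ^ 2)"
    by (intro homogeneous_mult homogeneous_Const homogeneous_power homogeneous_power_sum)+
  then have "homogeneous 4 f"
    unfolding f_def by (simp add: homogeneous_add)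
  moreover have "f \<in> carrier (poly_ring n)"
    unfolding f_def by (intro closed)
  moreover have "permute \<tau> f = f" if \<tau>: "\<tau> permutes {1..n+1}" for \<tau>
    by (simp only: f_def permute_add[OF \<tau>] permute_mult[OF \<tau>] permute_power[OF \<tau>]
      permute_power_sum[OF \<tau>] permute_Const[OF \<tau>])
  ultimately show ?thesis
    unfolding invariant_quartics_def carrier_quot_ring f_def[symmetric]
    using mem_coset_self[of f n] permute_image_coset[of _ n f] by blast
qed

lemma sos_quartics_coset:
  "C \<in> sos_quartics n \<longleftrightarrow> C \<in> invariant_quartics n \<and> (\<exists>f\<in>C. is_sos n f)"
  by (simp add: sos_quartics_def is_sos_def)

lemma is_sos_coset:
  assumes "is_sos n g" "g \<in> coset n f"
  shows "is_sos n f"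
proof -
  obtain h where h: "g = f + power_sum n 1 * h" "h \<in> carrier (poly_ring n)"
    using assms(2) by (auto simp: coset_def)
  have "f = g + power_sum n 1 * (- h)"
    by (simp add: h(1))
  then show ?thesis
    using is_sos_add[OF assms(1) is_sos_ideal[of "- h" n]] h(2) poly_ring_closed(3) by metis
qed

lemma sos_quartics_coset_iff:
  "coset n (Const a * power_sum n 4 + Const b * power_sum n 2 ^ 2) \<in> sos_quartics n
    \<longleftrightarrow> is_sos n (Const a * power_sum n 4 + Const b * power_sum n 2 ^ 2)"
  using sos_quartics_coset coset_invariant_quartic is_sos_coset mem_coset_self by metis

text \<open>
  Points of \<open>U n\<close> are extensional functions, but evaluation depends only on the coordinates in
  \<open>{1..n + 1}\<close>, so arbitrary functions may be used as points.
\<close>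

lemma psd_quartics_coset_iff:
  "coset n (Const a * power_sum n 4 + Const b * power_sum n 2 ^ 2) \<in> psd_quartics n
    \<longleftrightarrow> (\<forall>x. (\<Sum>i=1..n+1. x i) = 0
          \<longrightarrow> 0 \<le> a * (\<Sum>i=1..n+1. x i ^ 4) + b * (\<Sum>i=1..n+1. x i ^ 2) ^ 2)"
    (is "?C \<in> _ \<longleftrightarrow> (\<forall>x. _ \<longrightarrow> 0 \<le> ?F x)")
proof
  assume C: "?C \<in> psd_quartics n"
  show "\<forall>x. (\<Sum>i=1..n+1. x i) = 0 \<longrightarrow> 0 \<le> ?F x"
  proof (intro allI impI)
    fix x :: "nat \<Rightarrow> real" assume x: "(\<Sum>i=1..n+1. x i) = 0"
    define y where "y = restrict x {1..n+1}"
    have y: "(\<Sum>i=1..n+1. y i ^ k) = (\<Sum>i=1..n+1. x i ^ k)" for k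
      by (rule sum.cong) (simp_all add: y_def)
    have "y \<in> U n"
      using x y[of 1] by (simp add: U_def y_def)
    then have "0 \<le> eval_poly y (Const a * power_sum n 4 + Const b * power_sum n 2 ^ 2)"
      using C mem_coset_self unfolding psd_quartics_def by blast
    then show "0 \<le> ?F x"
      by (simp only: eval_poly_add eval_poly_mult eval_poly_Const eval_poly_power eval_power_sum y)
  qed
next
  assume F: "\<forall>x. (\<Sum>i=1..n+1. x i) = 0 \<longrightarrow> 0 \<le> ?F x"
  have "0 \<le> eval_poly x f" if f: "f \<in> ?C" and x: "x \<in> U n" for f x
  proof -
    have x0: "(\<Sum>i=1..n+1. x i) = 0"
      using x by (simp add: U_def)
    have "eval_poly x f = ?F x"
      unfolding eval_coset[OF f x0]
      by (simp only: eval_poly_add eval_poly_mult eval_poly_Const eval_poly_power eval_power_sum)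
    then show ?thesis
      using F x0 by simp
  qed
  then show "?C \<in> psd_quartics n"
    unfolding psd_quartics_def using coset_invariant_quartic by blast
qed

lemma sos_quartics_subset_psd_quartics: "sos_quartics n \<subseteq> psd_quartics n"
proof
  fix C assume C: "C \<in> sos_quartics n"
  then obtain f where f: "f \<in> C" "is_sos n f"
    by (auto simp: sos_quartics_coset)
  have inv: "C \<in> invariant_quartics n"
    using C by (simp add: sos_quartics_def)
  then obtain g where g: "C = coset n g"
    by (auto simp: invariant_quartics_def carrier_quot_ring)
  have "0 \<le> eval_poly a f'" if f': "f' \<in> C" and a: "a \<in> U n" for f' a
  proof -
    have a0: "(\<Sum>i=1..n+1. a i) = 0"
      using a by (simp add: U_def)
    have "eval_poly a f' = eval_poly a f"
      using f(1) f' eval_coset[OF _ a0] unfolding g by metis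
    then show ?thesis
      using is_sos_nonneg[OF f(2) a0] by simp
  qed
  then show "C \<in> psd_quartics n"
    unfolding psd_quartics_def using inv by blast
qed

section \<open>The dependence on parity\<close>

lemma alternating_sum: "(\<Sum>i=1..2 * k. (-1) ^ i) = (0::real)"
  by (induction k) simp_all

text \<open>
  Nonnegativity at the balanced sign vector \<open>i \<mapsto> (-1)\<^sup>i\<close>, which exists because \<open>n + 1\<close> is even, and at
  the vertex \<open>(N - 1, -1, \<dots>, -1)\<close> gives the two inequalities of \<open>is_sos_if_nonneg_on_rays\<close>.
\<close>

lemma psd_quartics_subset_sos_quartics:
  assumes "n \<ge> 2" "odd n"
  shows "psd_quartics n \<subseteq> sos_quartics n"
proof
  fix C assume C: "C \<in> psd_quartics n"
  define N where "N = real (n + 1)"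
  obtain a b where ab: "C = coset n (Const a * power_sum n 4 + Const b * power_sum n 2 ^ 2)"
    using C invariant_quartic_representative unfolding psd_quartics_def by blast
  have F: "0 \<le> a * (\<Sum>i=1..n+1. x i ^ 4) + b * (\<Sum>i=1..n+1. x i ^ 2) ^ 2"
    if "(\<Sum>i=1..n+1. x i) = 0" for x
    using C that unfolding ab psd_quartics_coset_iff by blast
  have N: "N > 2"
    using assms(1) by (simp add: N_def)
  obtain k where k: "n + 1 = 2 * k"
    using assms(2) by (metis even_Suc Suc_eq_plus1 evenE)
  have "0 \<le> a * (\<Sum>i=1..n+1. ((-1) ^ i) ^ 4) + b * (\<Sum>i=1..n+1. ((-1) ^ i) ^ 2) ^ 2"
    by (rule F) (simp only: k alternating_sum)
  moreover have "((-1) ^ i) ^ r = (1::real)" if "even r" for i r :: nat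
    using that by (simp flip: power_mult)
  ultimately have "0 \<le> a * N + b * N ^ 2"
    by (simp add: N_def del: of_nat_Suc)
  then have "0 \<le> N * (a + b * N)"
    by (simp add: power2_eq_square algebra_simps)
  then have balanced: "0 \<le> a + b * N"
    using N by (simp add: zero_le_mult_iff)
  define x where "x i = (if i = 1 then N - 1 else -1)" for i :: nat
  have split: "(\<Sum>i=1..n+1. f i) = f 1 + (\<Sum>i=2..n+1. f i)" for f :: "nat \<Rightarrow> real"
    by (simp add: sum.atLeast_Suc_atMost numeral_2_eq_2)
  have x: "(\<Sum>i=1..n+1. x i ^ r) = (N - 1) ^ r + (N - 1) * (- 1) ^ r" for r
    unfolding split by (simp add: x_def N_def)
  have "0 \<le> a * ((N - 1) ^ 4 + (N - 1)) + b * ((N - 1) ^ 2 + (N - 1)) ^ 2"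
    using F[of x] x[of 1] x[of 2] x[of 4] by simp
  also have "\<dots> = (N * (N - 1)) * (a * (N ^ 2 - 3 * N + 3) + b * (N * (N - 1)))"
    by (simp add: power_numeral_reduce algebra_simps)
  finally have "0 \<le> (N * (N - 1)) * (a * (N ^ 2 - 3 * N + 3) + b * (N * (N - 1)))" .
  moreover have "0 < N * (N - 1)"
    using N by simp
  ultimately have "0 \<le> a * (N ^ 2 - 3 * N + 3) + b * (N * (N - 1))"
    by (metis zero_le_mult_iff not_less)
  then have "is_sos n (Const a * power_sum n 4 + Const b * power_sum n 2 ^ 2)"
    using is_sos_if_nonneg_on_rays[OF assms(1)] balanced unfolding N_def by blast
  then show "C \<in> sos_quartics n"
    unfolding ab sos_quartics_coset_iff .
qed

lemma psd_not_sos_quartic: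
  assumes "n > 3" "even n"
  shows "\<exists>C \<in> psd_quartics n. C \<notin> sos_quartics n"
proof -
  define N where "N = real (n + 1)"
  define b where "b = - (1 / N + 1 / N ^ 3)"
  let ?f = "Const 1 * power_sum n 4 + Const b * power_sum n 2 ^ 2"
  have N: "N > 0"
    by (simp add: N_def)
  have "coset n ?f \<in> psd_quartics n"
    unfolding psd_quartics_coset_iff
  proof (intro allI impI)
    fix x :: "nat \<Rightarrow> real" assume x: "(\<Sum>i=1..n+1. x i) = 0"
    have "(1 / N + 1 / N ^ 3) * (\<Sum>i=1..n+1. x i ^ 2) ^ 2 \<le> (\<Sum>i=1..n+1. x i ^ 4)"
      using psd_separating_quartic[OF _ _ x] assms(2) unfolding N_def by simp
    then show "0 \<le> 1 * (\<Sum>i=1..n+1. x i ^ 4) + b * (\<Sum>i=1..n+1. x i ^ 2) ^ 2"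
      unfolding b_def by (simp only: mult_minus_left mult_1_left)
  qed
  moreover have "1 + b * N = - (1 / N ^ 2)"
    using N by (simp add: b_def field_simps power_numeral_reduce)
  then have "\<not> is_sos n ?f"
    using is_sos_necessary[OF assms(1), of 1 b] N by (auto simp: N_def)
  ultimately show ?thesis
    unfolding sos_quartics_coset_iff[symmetric] by blast
qed

theorem theorem3p2:
  fixes n :: nat
  assumes "n \<ge> 3"
  shows "psd_quartics n = sos_quartics n \<longleftrightarrow> odd n"
proof
  assume eq: "psd_quartics n = sos_quartics n"
  show "odd n"
  proof
    assume "even n"
    then have "n > 3"
      using assms by (cases "n = 3") auto
    then show False
      using psd_not_sos_quartic[OF _ \<open>even n\<close>] eq by blast
  qed
next
  assume "odd n"
  then show "psd_quartics n = sos_quartics n"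
    using assms psd_quartics_subset_sos_quartics[of n] sos_quartics_subset_psd_quartics[of n] by simp
qed

end
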